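(* Let $A$ be a PBW deformation of a noetherian quadratic geometric algebra, let $H=H(A)$ (which is geometric) have geometric data $(E,\sigma)$, and let $I$ be the kernel of the canonical surjection $H\to\mathcal B(E,\mathcal L,\sigma)$ onto the twisted homogeneous coordinate ring. If $M$ is a finite-dimensional simple $H$-module that is $I$-torsion, then either $M$ is a module over $\operatorname{gr}(A)$ (i.e. the $H$-action on $M$ factors through $H/x_0H\cong\operatorname{gr}(A)$) or $M$ is $1$-dimensional.
   Context: $K$ is an algebraically closed field of characteristic zero and all algebras are $K$-algebras. An algebra $A=K\langle x_1,\dots,x_n\mid f_1,\dots,f_m\rangle$ is given by generators $x_i$, all of degree 1, and polynomial relations $f_j$. For a noncommutative polynomial $f$ of degree $\alpha$, its homogenization $\hat f$ is obtained by multiplying each monomial of degree $\beta\le\alpha$ occurring in $f$ by $x_0^{\alpha-\beta}$, where $x_0$ is a new central indeterminate. The homogenization $H(A)$ is the $K$-algebra on $x_0,x_1,\dots,x_n$ with relations $\hat f_1,\dots,\hat f_m$ and $x_0x_i-x_ix_0$ for all $i$. $\operatorname{gr}(A)$ is the associated graded algebra of the standard filtration ($\mathcal F_\ell(A)$ is the span of monomials of degree at most $\ell$), identified with $H(A)/x_0H(A)$. $A$ is a PBW deformation of $\operatorname{gr}(A)$ if the canonical surjection $K\langle x_1,\dots,x_n\mid R\rangle\to\operatorname{gr}(A)$ is an isomorphism, where $R$ is the set of highest-degree homogeneous parts of $f_1,\dots,f_m$; the hypothesis is that this holds and $\operatorname{gr}(A)$ is a noetherian quadratic geometric algebra. Geometric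 algebras: let $H=T(V)/(R)$ be a homogeneous quadratic algebra, $V$ the span of the degree one generators and $R\subset V\otimes_K V$ the space of relations. An element $f=\sum\alpha_{ij}x_i\otimes x_j$ is evaluated at $p=(a_i)$, $q=(b_j)\in\mathbb P(V^* )$ by $f(p,q)=\sum\alpha_{ij}a_ib_j$, and $\mathcal V(R)=\{(p,q)\mid f(p,q)=0\ \forall f\in R\}$. $H$ is geometric, with geometric data $(E,\sigma)$, if there are a scheme $E\subset\mathbb P(V^* )$ and $\sigma\in\operatorname{Aut}(E)$ such that (G1) $\mathcal V(R)=\{(p,\sigma(p))\mid p\in E\}$ and (G2) $R=\{f\in V\otimes_K V\mid f(p,\sigma(p))=0\ \forall p\in E\}$. Twisted homogeneous coordinate ring: $\mathcal L=\mathcal O_E(1)$ is the restriction of $\mathcal O_{\mathbb P(V^* )}(1)$ to $E$, $\mathcal L_0=\mathcal O_E$, $\mathcal L_d=\mathcal L\otimes\mathcal L^{\sigma}\otimes\cdots\otimes\mathcal L^{\sigma^{d-1}}$ for $d\ge1$ (with $\mathcal L^\sigma=\sigma^*\mathcal L$), and $\mathcal B(E,\mathcal L,\sigma)=\bigoplus_{d\ge0}H^0(E,\mathcal L_d)$ with multiplication $a\cdot b=a\,\sigma^m(b)$ for $a\in\mathcal B_m$, $b\in\mathcal B_n$. For $H$ geometric, the identification of $H_1$ with $\mathcal B_1$ induces the canonical surjection $H\to\mathcal B(E,\mathcal L,\sigma)$. A simple $H$-module $M$ is $I$-torsion when it is annihilated by $I$, so that it may be regarded as a module over $H/I\cong\mathcal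 B$. *)

theory Defs
  imports "HOL-Algebra.Algebraic_Closure_Type" "HOL-Algebra.QuotRing" "HOL-Library.Poly_Mapping"
begin

section \<open>Finitely presented algebras\<close>

text \<open>Words form a monoid under concatenation, written additively because the monoid-algebra
  product of \<^theory>\<open>HOL-Library.Poly_Mapping\<close> expects additive exponents.  Hence
  \<open>'v list \<Rightarrow>\<^sub>0 'k\<close> is the free algebra \<open>K\<langle>x_v | v :: 'v\<rangle>\<close>.\<close>

instantiation list :: (type) monoid_add
begin
definition zero_list :: "'a list" where "zero_list = []"
definition plus_list :: "'a list \<Rightarrow> 'a list \<Rightarrow> 'a list" where "plus_list xs ys = xs @ ys"
instance by standard (simp_all add: zero_list_def plus_list_def)
end

type_synonym ('v, 'k) ncpoly = "'v list \<Rightarrow>\<^sub>0 'k"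

abbreviation free_algebra :: "('v, 'k::field) ncpoly ring" where
  "free_algebra \<equiv> ring_of_type_algebra"

definition ncvar :: "'v \<Rightarrow> ('v, 'k::field) ncpoly" where
  "ncvar v = Poly_Mapping.single [v] 1"

definition ncconst :: "'k \<Rightarrow> ('v, 'k::field) ncpoly" where
  "ncconst c = Poly_Mapping.single [] c"

text \<open>Homogeneous elements and components with respect to a degree function on monomials; used for
  words (\<open>length\<close>) and for commutative monomials (\<open>mdeg\<close> below).\<close>

definition homog :: "('m \<Rightarrow> nat) \<Rightarrow> nat \<Rightarrow> ('m \<Rightarrow>\<^sub>0 'k::zero) \<Rightarrow> bool" where
  "homog dg d f \<longleftrightarrow> (\<forall>m\<in>Poly_Mapping.keys f. dg m = d)"

definition hcomp :: "('m \<Rightarrow> nat) \<Rightarrow> nat \<Rightarrow> ('m \<Rightarrow>\<^sub>0 'k::comm_monoid_add) \<Rightarrow> ('m \<Rightarrow>\<^sub>0 'k)" where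
  "hcomp dg d f =
    (\<Sum>m\<in>{m \<in> Poly_Mapping.keys f. dg m = d}. Poly_Mapping.single m (Poly_Mapping.lookup f m))"

definition relideal :: "('v, 'k::field) ncpoly set \<Rightarrow> ('v, 'k) ncpoly set" where
  "relideal F = Idl\<^bsub>free_algebra\<^esub> F"

definition presented :: "('v, 'k::field) ncpoly set \<Rightarrow> ('v, 'k) ncpoly set ring" where
  "presented F = free_algebra Quot (relideal F)"

definition toalg :: "('v, 'k::field) ncpoly set \<Rightarrow> ('v, 'k) ncpoly \<Rightarrow> ('v, 'k) ncpoly set" where
  "toalg F f = relideal F +>\<^bsub>free_algebra\<^esub> f"

subsection \<open>Leading forms and homogenization\<close>

definition ncdeg :: "('v, 'k::field) ncpoly \<Rightarrow> nat" where
  "ncdeg f = Max (insert 0 (length ` Poly_Mapping.keys f))"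

definition leading_form :: "('v, 'k::field) ncpoly \<Rightarrow> ('v, 'k) ncpoly" where
  "leading_form f = hcomp length (ncdeg f) f"

text \<open>The generators of \<open>H(A)\<close> are indexed by \<open>'v option\<close>; \<open>None\<close> is the index of \<open>x\<^sub>0\<close>.  As \<open>x\<^sub>0\<close> is
  central in \<open>H(A)\<close>, the place where its power is inserted in a word is immaterial.\<close>

definition homogenize :: "('v, 'k::field) ncpoly \<Rightarrow> ('v option, 'k) ncpoly" where
  "homogenize f = (\<Sum>w\<in>Poly_Mapping.keys f.
     Poly_Mapping.single (replicate (ncdeg f - length w) None @ map Some w) (Poly_Mapping.lookup f w))"

definition homogenization_rels :: "('v, 'k::field) ncpoly set \<Rightarrow> ('v option, 'k) ncpoly set" where
  "homogenization_rels F =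
     homogenize ` F \<union> {ncvar None * ncvar i - ncvar i * ncvar None | i. True}"

subsection \<open>The associated graded algebra and PBW deformations\<close>

text \<open>The index is an integer so that \<open>F\<^sub>-\<^sub>1 = 0\<close> is available.\<close>

definition filtration ::
    "('v, 'k::field) ncpoly set \<Rightarrow> int \<Rightarrow> ('v, 'k) ncpoly set set" where
  "filtration F l = toalg F ` {f. \<forall>w\<in>Poly_Mapping.keys f. int (length w) \<le> l}"

definition gr_class ::
    "('v, 'k::field) ncpoly set \<Rightarrow> nat \<Rightarrow> ('v, 'k) ncpoly set \<Rightarrow> ('v, 'k) ncpoly set set" where
  "gr_class F l a = filtration F (int l - 1) +>\<^bsub>presented F\<^esub> a"

text \<open>Elements of the direct sum of the quotients \<open>F\<^sub>l / F\<^bsub>l-1\<^esub>\<close> are families indexed by \<open>l\<close>, almost all of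
  whose members are zero; the product is computed on representatives.\<close>

definition gr_algebra ::
    "('v, 'k::field) ncpoly set \<Rightarrow> (nat \<Rightarrow> ('v, 'k) ncpoly set set) ring" where
  "gr_algebra F =
    \<lparr>carrier = {g. (\<forall>l. \<exists>a\<in>filtration F (int l). g l = gr_class F l a) \<and>
                   finite {l. g l \<noteq> gr_class F l \<zero>\<^bsub>presented F\<^esub>}},
     monoid.mult = (\<lambda>g h l. gr_class F l (finsum (presented F)
               (\<lambda>i. (SOME a. a \<in> g i) \<otimes>\<^bsub>presented F\<^esub> (SOME b. b \<in> h (l - i))) {..l})),
     one = (\<lambda>l. gr_class F l (if l = 0 then \<one>\<^bsub>presented F\<^esub> else \<zero>\<^bsub>presented F\<^esub>)),
     ring.zero = (\<lambda>l. gr_class F l \<zero>\<^bsub>presented F\<^esub>),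
     add = (\<lambda>g h l. set_add (presented F) (g l) (h l))\<rparr>"

definition gr_map ::
    "('v, 'k::field) ncpoly set \<Rightarrow> ('v, 'k) ncpoly \<Rightarrow> nat \<Rightarrow> ('v, 'k) ncpoly set set" where
  "gr_map F f = (\<lambda>l. gr_class F l (toalg F (hcomp length l f)))"

definition PBW_deformation :: "('v, 'k::field) ncpoly set \<Rightarrow> bool" where
  "PBW_deformation F \<longleftrightarrow>
     (\<lambda>c. gr_map F (SOME f. f \<in> c)) \<in> ring_iso (presented (leading_form ` F)) (gr_algebra F)"

subsection \<open>Noetherian rings\<close>

text \<open>\<open>noetherian_ring\<close> of HOL-Algebra is about two-sided ideals, hence too weak here.\<close>

definition left_ideal :: "'a ring \<Rightarrow> 'a set \<Rightarrow> bool" where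
  "left_ideal R L \<longleftrightarrow> additive_subgroup L R \<and> (\<forall>r\<in>carrier R. \<forall>x\<in>L. r \<otimes>\<^bsub>R\<^esub> x \<in> L)"

definition right_ideal :: "'a ring \<Rightarrow> 'a set \<Rightarrow> bool" where
  "right_ideal R L \<longleftrightarrow> additive_subgroup L R \<and> (\<forall>r\<in>carrier R. \<forall>x\<in>L. x \<otimes>\<^bsub>R\<^esub> r \<in> L)"

definition noetherian :: "'a ring \<Rightarrow> bool" where
  "noetherian R \<longleftrightarrow> ring R \<and>
     (\<forall>L. left_ideal R L \<longrightarrow>
        (\<exists>G. finite G \<and> G \<subseteq> L \<and> (\<forall>L'. left_ideal R L' \<and> G \<subseteq> L' \<longrightarrow> L \<subseteq> L'))) \<and>
     (\<forall>L. right_ideal R L \<longrightarrow>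
        (\<exists>G. finite G \<and> G \<subseteq> L \<and> (\<forall>L'. right_ideal R L' \<and> G \<subseteq> L' \<longrightarrow> L \<subseteq> L')))"

section \<open>Closed subschemes of projective space\<close>

text \<open>A homogeneous ideal \<open>\<aa>\<close> of the polynomial ring \<open>S\<close> on the generators (the symmetric algebra of
  \<open>V\<close>) presents the closed subscheme \<open>E = Proj (S/\<aa>)\<close> of \<open>P(V*) = Proj S\<close>; every closed subscheme
  arises in this way.  The points are all homogeneous primes (not only the closed ones).\<close>

type_synonym ('v, 'k) mpoly = "('v \<Rightarrow>\<^sub>0 nat) \<Rightarrow>\<^sub>0 'k"
type_synonym ('v, 'k) pt = "('v, 'k) mpoly set"
type_synonym ('v, 'k) germ = "(('v, 'k) mpoly \<times> ('v, 'k) mpoly) set"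
type_synonym ('v, 'k) sect = "('v, 'k) pt \<Rightarrow> ('v, 'k) germ"

abbreviation mpoly_ring :: "('v, 'k::field) mpoly ring" where
  "mpoly_ring \<equiv> ring_of_type_algebra"

definition mdeg :: "('v \<Rightarrow>\<^sub>0 nat) \<Rightarrow> nat" where
  "mdeg m = (\<Sum>i\<in>Poly_Mapping.keys m. Poly_Mapping.lookup m i)"

definition mvar :: "'v \<Rightarrow> ('v, 'k::field) mpoly" where
  "mvar v = Poly_Mapping.single (Poly_Mapping.single v 1) 1"

definition mconst :: "'k \<Rightarrow> ('v, 'k::field) mpoly" where
  "mconst c = Poly_Mapping.single 0 c"

definition homogeneous_ideal :: "('v, 'k::field) mpoly set \<Rightarrow> bool" where
  "homogeneous_ideal \<aa> \<longleftrightarrow> ideal \<aa> mpoly_ring \<and> (\<forall>f\<in>\<aa>. \<forall>d. hcomp mdeg d f \<in> \<aa>)"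

definition proj_pts :: "('v, 'k::field) mpoly set \<Rightarrow> ('v, 'k) pt set" where
  "proj_pts \<aa> = {\<pp>. primeideal \<pp> mpoly_ring \<and> homogeneous_ideal \<pp> \<and> \<aa> \<subseteq> \<pp> \<and> \<not> range mvar \<subseteq> \<pp>}"

definition zopen :: "('v, 'k::field) mpoly set \<Rightarrow> ('v, 'k) pt set \<Rightarrow> bool" where
  "zopen \<aa> U \<longleftrightarrow> (\<exists>F. (\<forall>f\<in>F. \<exists>d. homog mdeg d f) \<and> U = {\<pp> \<in> proj_pts \<aa>. \<not> F \<subseteq> \<pp>})"

text \<open>\<open>frac \<aa> \<pp> m a b\<close> is the fraction \<open>a/b\<close> in the homogeneous localization of \<open>S/\<aa>\<close> at \<open>\<pp>\<close>, where the
  degree of \<open>a\<close> exceeds that of \<open>b\<close> by \<open>m\<close>.  So \<open>stalk \<aa> m \<pp>\<close> is the degree \<open>m\<close> part of that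
  localization, the stalk of \<open>\<O>\<^sub>E(m)\<close>.\<close>

definition frac :: "('v, 'k::field) mpoly set \<Rightarrow> ('v, 'k) pt \<Rightarrow> nat \<Rightarrow>
    ('v, 'k) mpoly \<Rightarrow> ('v, 'k) mpoly \<Rightarrow> ('v, 'k) germ" where
  "frac \<aa> \<pp> m a b =
     {(a', b'). (\<exists>d. homog mdeg (d + m) a' \<and> homog mdeg d b') \<and> b' \<notin> \<pp> \<and>
                (\<exists>t e. homog mdeg e t \<and> t \<notin> \<pp> \<and> t * (a * b' - a' * b) \<in> \<aa>)}"

definition stalk :: "('v, 'k::field) mpoly set \<Rightarrow> nat \<Rightarrow> ('v, 'k) pt \<Rightarrow> ('v, 'k) germ set" where
  "stalk \<aa> m \<pp> = {frac \<aa> \<pp> m a b | a b d. homog mdeg (d + m) a \<and> homog mdeg d b \<and> b \<notin> \<pp>}"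

definition gadd :: "('v, 'k::field) mpoly set \<Rightarrow> nat \<Rightarrow> ('v, 'k) pt \<Rightarrow>
    ('v, 'k) germ \<Rightarrow> ('v, 'k) germ \<Rightarrow> ('v, 'k) germ" where
  "gadd \<aa> m \<pp> x y = (case (SOME u. u \<in> x, SOME v. v \<in> y) of
     ((a, b), (c, d)) \<Rightarrow> frac \<aa> \<pp> m (a * d + c * b) (b * d))"

text \<open>Multiplication of the stalk of \<open>\<O>\<^sub>E\<close> on the stalk of \<open>\<O>\<^sub>E(m)\<close>.\<close>

definition gmult :: "('v, 'k::field) mpoly set \<Rightarrow> nat \<Rightarrow> ('v, 'k) pt \<Rightarrow>
    ('v, 'k) germ \<Rightarrow> ('v, 'k) germ \<Rightarrow> ('v, 'k) germ" where
  "gmult \<aa> m \<pp> x y = (case (SOME u. u \<in> x, SOME v. v \<in> y) of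
     ((a, b), (c, d)) \<Rightarrow> frac \<aa> \<pp> m (a * c) (b * d))"

definition sections :: "('v, 'k::field) mpoly set \<Rightarrow> nat \<Rightarrow> ('v, 'k) pt set \<Rightarrow> ('v, 'k) sect set" where
  "sections \<aa> m U = {s \<in> extensional U. \<forall>p\<in>U. \<exists>W a b d.
      zopen \<aa> W \<and> p \<in> W \<and> W \<subseteq> U \<and> homog mdeg (d + m) a \<and> homog mdeg d b \<and>
      (\<forall>q\<in>W. b \<notin> q \<and> s q = frac \<aa> q m a b)}"

definition const_section ::
    "('v, 'k::field) mpoly set \<Rightarrow> ('v, 'k) pt set \<Rightarrow> 'k \<Rightarrow> ('v, 'k) sect" where
  "const_section \<aa> U c = restrict (\<lambda>p. frac \<aa> p 0 (mconst c) 1) U"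

definition structure_ring ::
    "('v, 'k::field) mpoly set \<Rightarrow> ('v, 'k) pt set \<Rightarrow> ('v, 'k) sect ring" where
  "structure_ring \<aa> U =
    \<lparr>carrier = sections \<aa> 0 U,
     monoid.mult = (\<lambda>s t. restrict (\<lambda>p. gmult \<aa> 0 p (s p) (t p)) U),
     one = const_section \<aa> U 1,
     ring.zero = const_section \<aa> U 0,
     add = (\<lambda>s t. restrict (\<lambda>p. gadd \<aa> 0 p (s p) (t p)) U)\<rparr>"

subsection \<open>Automorphisms\<close>

record ('p, 's) ringed_map =
  on_pts :: "'p \<Rightarrow> 'p"
  comorph :: "'p set \<Rightarrow> 's \<Rightarrow> 's"

type_synonym ('v, 'k) scheme_map = "(('v, 'k) pt, ('v, 'k) sect) ringed_map"

definition preim :: "('v, 'k::field) mpoly set \<Rightarrow> ('v, 'k) scheme_map \<Rightarrow>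
    ('v, 'k) pt set \<Rightarrow> ('v, 'k) pt set" where
  "preim \<aa> \<sigma> U = {p \<in> proj_pts \<aa>. on_pts \<sigma> p \<in> U}"

text \<open>Automorphisms of the \<open>K\<close>-scheme: a homeomorphism together with an isomorphism of sheaves of
  \<open>K\<close>-algebras \<open>\<O>(U) \<rightarrow> \<O>(\<sigma>\<^sup>-\<^sup>1 U)\<close>.  The stalk maps, being isomorphisms, are automatically local.\<close>

definition scheme_aut :: "('v, 'k::field) mpoly set \<Rightarrow> ('v, 'k) scheme_map \<Rightarrow> bool" where
  "scheme_aut \<aa> \<sigma> \<longleftrightarrow>
     bij_betw (on_pts \<sigma>) (proj_pts \<aa>) (proj_pts \<aa>) \<and>
     (\<forall>U. U \<subseteq> proj_pts \<aa> \<longrightarrow> (zopen \<aa> (preim \<aa> \<sigma> U) \<longleftrightarrow> zopen \<aa> U)) \<and>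
     (\<forall>U. zopen \<aa> U \<longrightarrow>
        comorph \<sigma> U \<in> ring_iso (structure_ring \<aa> U) (structure_ring \<aa> (preim \<aa> \<sigma> U)) \<and>
        (\<forall>c. comorph \<sigma> U (const_section \<aa> U c) = const_section \<aa> (preim \<aa> \<sigma> U) c) \<and>
        (\<forall>W s. zopen \<aa> W \<and> W \<subseteq> U \<and> s \<in> sections \<aa> 0 U \<longrightarrow>
           comorph \<sigma> W (restrict s W) = restrict (comorph \<sigma> U s) (preim \<aa> \<sigma> W)))"

fun aut_pow :: "('v, 'k::field) mpoly set \<Rightarrow> ('v, 'k) scheme_map \<Rightarrow> nat \<Rightarrow> ('v, 'k) scheme_map" where
  "aut_pow \<aa> \<sigma> 0 = \<lparr>on_pts = id, comorph = (\<lambda>U. id)\<rparr>"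
| "aut_pow \<aa> \<sigma> (Suc k) =
     \<lparr>on_pts = on_pts \<sigma> \<circ> on_pts (aut_pow \<aa> \<sigma> k),
      comorph = (\<lambda>U. comorph (aut_pow \<aa> \<sigma> k) (preim \<aa> \<sigma> U) \<circ> comorph \<sigma> U)\<rparr>"

text \<open>The induced map from the stalk of \<open>\<O>\<^sub>E\<close> at \<open>\<tau> p\<close> to the stalk at \<open>p\<close>.\<close>

definition stalk_map :: "('v, 'k::field) mpoly set \<Rightarrow> ('v, 'k) scheme_map \<Rightarrow> ('v, 'k) pt \<Rightarrow>
    ('v, 'k) germ \<Rightarrow> ('v, 'k) germ" where
  "stalk_map \<aa> \<tau> p g = (SOME h. \<exists>U s. zopen \<aa> U \<and> on_pts \<tau> p \<in> U \<and> s \<in> sections \<aa> 0 U \<and>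
      s (on_pts \<tau> p) = g \<and> h = comorph \<tau> U s p)"

section \<open>The twisted homogeneous coordinate ring\<close>

subsection \<open>The invertible sheaves \<open>\<L>\<^sub>d\<close>\<close>

text \<open>Write \<open>\<O>\<^sub>p\<close> and \<open>\<L>\<^sub>p\<close> for the stalks at \<open>p\<close> of \<open>\<O>\<^sub>E\<close> and of \<open>\<L> = \<O>\<^sub>E(1)\<close>.  The stalk at \<open>p\<close> of the
  pullback of \<open>\<L>\<close> along \<open>\<sigma>\<^sup>k\<close> is \<open>\<O>\<^sub>p \<otimes> \<L>\<^bsub>\<sigma>\<^sup>k p\<^esub>\<close>, the tensor product being taken over the stalk of
  \<open>\<O>\<^sub>E\<close> at \<open>\<sigma>\<^sup>k p\<close>, which acts on \<open>\<O>\<^sub>p\<close> through the stalk map of \<open>\<sigma>\<^sup>k\<close>.  Hence the stalk of \<open>\<L>\<^sub>d\<close> at \<open>p\<close> is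
  the abelian group generated by symbols \<open>r \<otimes> m\<^sub>0 \<otimes> \<dots> \<otimes> m\<^bsub>d-1\<^esub>\<close> with \<open>r\<close> in \<open>\<O>\<^sub>p\<close> and \<open>m\<^sub>k\<close> in the stalk of
  \<open>\<L>\<close> at \<open>\<sigma>\<^sup>k p\<close>, which are additive in each argument and satisfy
  \<open>r (\<sigma>\<^sup>k)\<^sup>#(a) \<otimes> \<dots> \<otimes> m\<^sub>k \<otimes> \<dots> = r \<otimes> \<dots> \<otimes> a m\<^sub>k \<otimes> \<dots>\<close>.  For \<open>d = 0\<close> this is \<open>\<O>\<^sub>p\<close>.
  All these groups are subquotients of the free abelian group on pairs \<open>(r, [m\<^sub>0, \<dots>, m\<^bsub>d-1\<^esub>])\<close>, of one
  type for all \<open>d\<close>.\<close>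

type_synonym ('v, 'k) symb = "('v, 'k) germ \<times> ('v, 'k) germ list"
type_synonym ('v, 'k) tensor = "(('v, 'k) symb \<Rightarrow>\<^sub>0 int) set"

definition symbols :: "('v, 'k::field) mpoly set \<Rightarrow> ('v, 'k) scheme_map \<Rightarrow> nat \<Rightarrow> ('v, 'k) pt \<Rightarrow>
    ('v, 'k) symb set" where
  "symbols \<aa> \<sigma> d p = {(r, ms). r \<in> stalk \<aa> 0 p \<and> length ms = d \<and>
      (\<forall>k<d. ms ! k \<in> stalk \<aa> 1 (on_pts (aut_pow \<aa> \<sigma> k) p))}"

definition tensor_rels :: "('v, 'k::field) mpoly set \<Rightarrow> ('v, 'k) scheme_map \<Rightarrow> nat \<Rightarrow> ('v, 'k) pt \<Rightarrow>
    (('v, 'k) symb \<Rightarrow>\<^sub>0 int) set" where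
  "tensor_rels \<aa> \<sigma> d p =
     {Poly_Mapping.single (gadd \<aa> 0 p r r', ms) 1
        - Poly_Mapping.single (r, ms) 1 - Poly_Mapping.single (r', ms) 1 | r r' ms.
        (r, ms) \<in> symbols \<aa> \<sigma> d p \<and> (r', ms) \<in> symbols \<aa> \<sigma> d p} \<union>
     {Poly_Mapping.single (r, ms[k := gadd \<aa> 1 (on_pts (aut_pow \<aa> \<sigma> k) p) x y]) 1
        - Poly_Mapping.single (r, ms[k := x]) 1 - Poly_Mapping.single (r, ms[k := y]) 1 | r ms k x y.
        k < d \<and> (r, ms[k := x]) \<in> symbols \<aa> \<sigma> d p \<and> (r, ms[k := y]) \<in> symbols \<aa> \<sigma> d p} \<union>
     {Poly_Mapping.single (gmult \<aa> 0 p r (stalk_map \<aa> (aut_pow \<aa> \<sigma> k) p a), ms) 1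
        - Poly_Mapping.single (r, ms[k := gmult \<aa> 1 (on_pts (aut_pow \<aa> \<sigma> k) p) a (ms ! k)]) 1
        | r ms k a.
        k < d \<and> (r, ms) \<in> symbols \<aa> \<sigma> d p \<and> a \<in> stalk \<aa> 0 (on_pts (aut_pow \<aa> \<sigma> k) p)}"

inductive_set additive_span :: "'a::ab_group_add set \<Rightarrow> 'a set" for G where
  base: "x \<in> G \<Longrightarrow> x \<in> additive_span G"
| zero: "0 \<in> additive_span G"
| diff: "x \<in> additive_span G \<Longrightarrow> y \<in> additive_span G \<Longrightarrow> x - y \<in> additive_span G"

definition tclass :: "('v, 'k::field) mpoly set \<Rightarrow> ('v, 'k) scheme_map \<Rightarrow> nat \<Rightarrow> ('v, 'k) pt \<Rightarrow>
    (('v, 'k) symb \<Rightarrow>\<^sub>0 int) \<Rightarrow> ('v, 'k) tensor" where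
  "tclass \<aa> \<sigma> d p t = {t'. t' - t \<in> additive_span (tensor_rels \<aa> \<sigma> d p)}"

text \<open>\<open>\<L>\<^sub>d(U)\<close>: families of elements of the stalks which locally are finite sums
  \<open>\<Sum> r \<otimes> m\<^sub>0 \<otimes> \<dots> \<otimes> m\<^bsub>d-1\<^esub>\<close> with \<open>r \<in> \<O>(W)\<close> and \<open>m\<^sub>k \<in> \<L>(\<sigma>\<^sup>k W)\<close>, i.e. the sheafification of the tensor
  product presheaf.\<close>

definition Ld_sections :: "('v, 'k::field) mpoly set \<Rightarrow> ('v, 'k) scheme_map \<Rightarrow> nat \<Rightarrow>
    ('v, 'k) pt set \<Rightarrow> (('v, 'k) pt \<Rightarrow> ('v, 'k) tensor) set" where
  "Ld_sections \<aa> \<sigma> d U = {b \<in> extensional U. \<forall>p\<in>U. \<exists>W ts.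
      zopen \<aa> W \<and> p \<in> W \<and> W \<subseteq> U \<and>
      (\<forall>(r, ms)\<in>set ts. r \<in> sections \<aa> 0 W \<and> length ms = d \<and>
         (\<forall>k<d. ms ! k \<in> sections \<aa> 1 (on_pts (aut_pow \<aa> \<sigma> k) ` W))) \<and>
      (\<forall>q\<in>W. b q = tclass \<aa> \<sigma> d q (\<Sum>(r, ms)\<leftarrow>ts.
         Poly_Mapping.single (r q, map (\<lambda>k. (ms ! k) (on_pts (aut_pow \<aa> \<sigma> k) q)) [0..<d]) 1))}"

subsection \<open>The ring \<open>\<B>(E, \<L>, \<sigma>)\<close>\<close>

text \<open>On stalks, \<open>a \<cdot> b = a \<sigma>\<^sup>i(b)\<close> for \<open>a\<close> of degree \<open>i\<close> is the bilinear map with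
  \<open>(r \<otimes> m\<^sub>0 \<otimes> \<dots>, r' \<otimes> m'\<^sub>0 \<otimes> \<dots>) \<mapsto> r (\<sigma>\<^sup>i)\<^sup>#(r') \<otimes> m\<^sub>0 \<otimes> \<dots> \<otimes> m'\<^sub>0 \<otimes> \<dots>\<close>, where the first
  factor lives at \<open>p\<close> and the second one at \<open>\<sigma>\<^sup>i p\<close>.\<close>

definition tmult :: "('v, 'k::field) mpoly set \<Rightarrow> ('v, 'k) scheme_map \<Rightarrow> nat \<Rightarrow> ('v, 'k) pt \<Rightarrow>
    (('v, 'k) symb \<Rightarrow>\<^sub>0 int) \<Rightarrow> (('v, 'k) symb \<Rightarrow>\<^sub>0 int) \<Rightarrow> (('v, 'k) symb \<Rightarrow>\<^sub>0 int)" where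
  "tmult \<aa> \<sigma> i p t t' = (\<Sum>(r, ms)\<in>Poly_Mapping.keys t. \<Sum>(r', ms')\<in>Poly_Mapping.keys t'.
     Poly_Mapping.single (gmult \<aa> 0 p r (stalk_map \<aa> (aut_pow \<aa> \<sigma> i) p r'), ms @ ms')
       (Poly_Mapping.lookup t (r, ms) * Poly_Mapping.lookup t' (r', ms')))"

definition tcr_zero :: "('v, 'k::field) mpoly set \<Rightarrow> ('v, 'k) scheme_map \<Rightarrow>
    nat \<Rightarrow> ('v, 'k) pt \<Rightarrow> ('v, 'k) tensor" where
  "tcr_zero \<aa> \<sigma> d = restrict (\<lambda>p. tclass \<aa> \<sigma> d p 0) (proj_pts \<aa>)"

definition tcr_const :: "('v, 'k::field) mpoly set \<Rightarrow> ('v, 'k) scheme_map \<Rightarrow> 'k \<Rightarrow>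
    nat \<Rightarrow> ('v, 'k) pt \<Rightarrow> ('v, 'k) tensor" where
  "tcr_const \<aa> \<sigma> c d = (if d = 0
     then restrict (\<lambda>p. tclass \<aa> \<sigma> 0 p (Poly_Mapping.single (frac \<aa> p 0 (mconst c) 1, []) 1)) (proj_pts \<aa>)
     else tcr_zero \<aa> \<sigma> d)"

text \<open>The restriction to \<open>E\<close> of the coordinate \<open>x\<^sub>v\<close>, a global section of \<open>\<L>\<^sub>1 = \<L>\<close>.\<close>

definition tcr_var :: "('v, 'k::field) mpoly set \<Rightarrow> ('v, 'k) scheme_map \<Rightarrow> 'v \<Rightarrow>
    nat \<Rightarrow> ('v, 'k) pt \<Rightarrow> ('v, 'k) tensor" where
  "tcr_var \<aa> \<sigma> v d = (if d = 1
     then restrict (\<lambda>p. tclass \<aa> \<sigma> 1 p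
            (Poly_Mapping.single (frac \<aa> p 0 1 1, [frac \<aa> p 1 (mvar v) 1]) 1)) (proj_pts \<aa>)
     else tcr_zero \<aa> \<sigma> d)"

definition twisted_coordinate_ring :: "('v, 'k::field) mpoly set \<Rightarrow> ('v, 'k) scheme_map \<Rightarrow>
    (nat \<Rightarrow> ('v, 'k) pt \<Rightarrow> ('v, 'k) tensor) ring" where
  "twisted_coordinate_ring \<aa> \<sigma> =
    \<lparr>carrier = {b. (\<forall>d. b d \<in> Ld_sections \<aa> \<sigma> d (proj_pts \<aa>)) \<and> finite {d. b d \<noteq> tcr_zero \<aa> \<sigma> d}},
     monoid.mult = (\<lambda>b c l. restrict (\<lambda>p. tclass \<aa> \<sigma> l p (\<Sum>i\<le>l. tmult \<aa> \<sigma> i p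
               (SOME t. t \<in> b i p)
               (SOME t. t \<in> c (l - i) (on_pts (aut_pow \<aa> \<sigma> i) p)))) (proj_pts \<aa>)),
     one = tcr_const \<aa> \<sigma> 1,
     ring.zero = tcr_zero \<aa> \<sigma>,
     add = (\<lambda>b c d. restrict (\<lambda>p. {t + t' | t t'. t \<in> b d p \<and> t' \<in> c d p}) (proj_pts \<aa>))\<rparr>"

section \<open>Geometric algebras\<close>

definition V2 :: "('v, 'k::field) ncpoly set" where
  "V2 = {f. homog length 2 f}"

text \<open>The algebra presented by \<open>F\<close> is (homogeneous) quadratic if it is \<open>T(V)/(R)\<close> for a subspace \<open>R\<close> of
  \<open>V \<otimes> V\<close>; then \<open>R\<close> is necessarily the degree two part of the ideal of relations.\<close>

definition quadratic_rels :: "('v, 'k::field) ncpoly set \<Rightarrow> ('v, 'k) ncpoly set" where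
  "quadratic_rels F = relideal F \<inter> V2"

definition quadratic_algebra :: "('v, 'k::field) ncpoly set \<Rightarrow> bool" where
  "quadratic_algebra F \<longleftrightarrow> relideal F = relideal (quadratic_rels F)"

definition eval2 :: "('v, 'k::field) ncpoly \<Rightarrow> ('v \<Rightarrow> 'k) \<Rightarrow> ('v \<Rightarrow> 'k) \<Rightarrow> 'k" where
  "eval2 f a b = (\<Sum>w\<in>Poly_Mapping.keys f. Poly_Mapping.lookup f w * a (w ! 0) * b (w ! 1))"

definition meval :: "('v \<Rightarrow> 'k) \<Rightarrow> ('v, 'k::field) mpoly \<Rightarrow> 'k" where
  "meval a f = (\<Sum>m\<in>Poly_Mapping.keys f. Poly_Mapping.lookup f m *
     (\<Prod>i\<in>Poly_Mapping.keys m. a i ^ Poly_Mapping.lookup m i))"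

text \<open>The \<open>K\<close>-rational point of \<open>P(V*)\<close> with homogeneous coordinates \<open>a \<noteq> 0\<close>, as a homogeneous prime.\<close>

definition kpoint :: "('v \<Rightarrow> 'k) \<Rightarrow> ('v, 'k::field) pt" where
  "kpoint a = {f. \<forall>d. meval a (hcomp mdeg d f) = 0}"

definition kpoints :: "('v, 'k::field) mpoly set \<Rightarrow> ('v, 'k) pt set" where
  "kpoints \<aa> = {kpoint a | a. a \<noteq> (\<lambda>_. 0)} \<inter> proj_pts \<aa>"

definition zero_locus :: "('v, 'k::field) ncpoly set \<Rightarrow> (('v, 'k) pt \<times> ('v, 'k) pt) set" where
  "zero_locus R = {(kpoint a, kpoint b) | a b.
     a \<noteq> (\<lambda>_. 0) \<and> b \<noteq> (\<lambda>_. 0) \<and> (\<forall>f\<in>R. eval2 f a b = 0)}"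

text \<open>The two conditions on \<open>(E, \<sigma>)\<close> evaluate relations at \<open>K\<close>-rational points, which \<open>\<sigma>\<close> permutes;
  \<open>E\<close> itself may be non-reduced or reducible.\<close>

definition geometric_data :: "('v, 'k::field) ncpoly set \<Rightarrow> ('v, 'k) mpoly set \<Rightarrow>
    ('v, 'k) scheme_map \<Rightarrow> bool" where
  "geometric_data F \<aa> \<sigma> \<longleftrightarrow>
     quadratic_algebra F \<and> homogeneous_ideal \<aa> \<and> scheme_aut \<aa> \<sigma> \<and>
     zero_locus (quadratic_rels F) = {(p, on_pts \<sigma> p) | p. p \<in> kpoints \<aa>} \<and>
     quadratic_rels F = {f \<in> V2. \<forall>a b. a \<noteq> (\<lambda>_. 0) \<and> b \<noteq> (\<lambda>_. 0) \<and>
        kpoint a \<in> proj_pts \<aa> \<and> kpoint b = on_pts \<sigma> (kpoint a) \<longrightarrow> eval2 f a b = 0}"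

definition geometric_algebra :: "('v, 'k::field) ncpoly set \<Rightarrow> bool" where
  "geometric_algebra F \<longleftrightarrow> (\<exists>\<aa> \<sigma>. geometric_data F \<aa> \<sigma>)"

text \<open>The canonical map \<open>H \<rightarrow> \<B>(E, \<L>, \<sigma>)\<close>: the \<open>K\<close>-algebra homomorphism sending each generator to its
  restriction to \<open>E\<close>.  It is unique on \<open>H\<close>, since the generators generate \<open>H\<close>.  Surjectivity is not imposed.\<close>

definition canonical_map :: "('v, 'k::field) ncpoly set \<Rightarrow> ('v, 'k) mpoly set \<Rightarrow>
    ('v, 'k) scheme_map \<Rightarrow> (('v, 'k) ncpoly set \<Rightarrow> nat \<Rightarrow> ('v, 'k) pt \<Rightarrow> ('v, 'k) tensor) \<Rightarrow> bool" where
  "canonical_map F \<aa> \<sigma> \<phi> \<longleftrightarrow>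
     \<phi> \<in> ring_hom (presented F) (twisted_coordinate_ring \<aa> \<sigma>) \<and>
     (\<forall>c. \<phi> (toalg F (ncconst c)) = tcr_const \<aa> \<sigma> c) \<and>
     (\<forall>v. \<phi> (toalg F (ncvar v)) = tcr_var \<aa> \<sigma> v)"

section \<open>Modules\<close>

definition left_module :: "'r ring \<Rightarrow> ('r \<Rightarrow> 'm::ab_group_add \<Rightarrow> 'm) \<Rightarrow> bool" where
  "left_module R act \<longleftrightarrow>
     (\<forall>r\<in>carrier R. \<forall>x y. act r (x + y) = act r x + act r y) \<and>
     (\<forall>r\<in>carrier R. \<forall>s\<in>carrier R. \<forall>x. act (r \<oplus>\<^bsub>R\<^esub> s) x = act r x + act s x) \<and>
     (\<forall>r\<in>carrier R. \<forall>s\<in>carrier R. \<forall>x. act (r \<otimes>\<^bsub>R\<^esub> s) x = act r (act s x)) \<and>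
     (\<forall>x. act \<one>\<^bsub>R\<^esub> x = x)"

definition simple_module :: "'r ring \<Rightarrow> ('r \<Rightarrow> 'm::ab_group_add \<Rightarrow> 'm) \<Rightarrow> bool" where
  "simple_module R act \<longleftrightarrow> left_module R act \<and> (\<exists>x::'m. x \<noteq> 0) \<and>
     (\<forall>N. 0 \<in> N \<and> (\<forall>x\<in>N. \<forall>y\<in>N. x + y \<in> N) \<and> (\<forall>r\<in>carrier R. \<forall>x\<in>N. act r x \<in> N) \<longrightarrow>
        N = {0} \<or> N = UNIV)"

text \<open>The \<open>K\<close>-vector space structure underlying a module over a presented \<open>K\<close>-algebra.\<close>

definition kscale :: "('v, 'k::field) ncpoly set \<Rightarrow> (('v, 'k) ncpoly set \<Rightarrow> 'm \<Rightarrow> 'm) \<Rightarrow> 'k \<Rightarrow> 'm \<Rightarrow> 'm" where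
  "kscale F act c x = act (toalg F (ncconst c)) x"

definition finite_dimensional :: "('k::field \<Rightarrow> 'm::ab_group_add \<Rightarrow> 'm) \<Rightarrow> bool" where
  "finite_dimensional sc \<longleftrightarrow> (\<exists>B. finite B \<and> module.span sc B = UNIV)"

text \<open>The action factors through the quotient of \<open>R\<close> by the two-sided ideal \<open>J\<close>.\<close>

definition action_factors ::
    "'r ring \<Rightarrow> 'r set \<Rightarrow> ('r \<Rightarrow> 'm::ab_group_add \<Rightarrow> 'm) \<Rightarrow> bool" where
  "action_factors R J act \<longleftrightarrow>
     (\<exists>act'. left_module (R Quot J) act' \<and> (\<forall>r\<in>carrier R. \<forall>x. act r x = act' (J +>\<^bsub>R\<^esub> r) x))"

end

theory Submission
  imports Defs
begin

text \<open>The generator \<open>x\<^sub>0\<close> is central in \<open>H\<close>, hence so is its image in \<open>\<B>\<close>.  Computing in the stalks of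
  \<open>\<L>\<^sub>3\<close>, which are generated by one element, centrality of \<open>x\<^sub>0\<close> alone already yields
  \<open>x\<^sub>i x\<^sub>j x\<^sub>0 = x\<^sub>j x\<^sub>i x\<^sub>0\<close> in \<open>\<B>\<close>; this needs no information about the points of \<open>E\<close> and holds for
  non-reduced \<open>E\<close> as well.  So \<open>[x\<^sub>i, x\<^sub>j] x\<^sub>0 \<in> I\<close> annihilates \<open>M\<close>.  As \<open>x\<^sub>0 M\<close> is a submodule, either
  \<open>x\<^sub>0 M = 0\<close> and \<open>M\<close> is a module over \<open>H/x\<^sub>0H\<close>, or \<open>x\<^sub>0 M = M\<close>; then all generators commute on \<open>M\<close>,
  each eigenspace of a generator is a submodule, every element of \<open>H\<close> acts by a scalar, and \<open>M\<close> is a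
  line.\<close>

text \<open>The trailing factor x_0 of the commutator relation cannot be cancelled in B: where the
  germs of x_0 vanish, every identity that comes from its centrality reads 0 = 0. It is the
  surjectivity of x_0 on M that removes it. The main obstacle is that B multiplies by means of
  chosen representatives, in quotients of free abelian groups on symbols whose entries are
  themselves classes of fractions. A product of coordinates can be evaluated only after three
  independences are settled: of the germ operations from the chosen fractions, of the stalk maps
  from the chosen sections, and of \<open>tmult\<close> from the chosen tensors. The stalks are
  nowhere shown to be free of rank one. Identities between multiples of a local generator are
  treated as equalities of classes, which may be multiplied by coefficients but never
  divided.\<close>

lemma carrier_type_ring [simp]: "carrier (ring_of_type_algebra :: 'a::ring_1 ring) = UNIV"
  and mult_type_ring [simp]: "x \<otimes>\<^bsub>ring_of_type_algebra\<^esub> y = x * (y :: 'a)"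
  and add_type_ring [simp]: "x \<oplus>\<^bsub>ring_of_type_algebra\<^esub> y = x + (y :: 'a)"
  and one_type_ring [simp]: "\<one>\<^bsub>ring_of_type_algebra\<^esub> = (1 :: 'a)"
  and zero_type_ring [simp]: "\<zero>\<^bsub>ring_of_type_algebra\<^esub> = (0 :: 'a)"
  by (simp_all add: ring_of_type_algebra_def)

section \<open>Homogeneous fractions\<close>

lemma mdeg_add: "mdeg (m + n) = mdeg m + mdeg n"
proof -
  let ?K = "Poly_Mapping.keys m \<union> Poly_Mapping.keys n"
  have aux: "mdeg q = (\<Sum>i\<in>?K. Poly_Mapping.lookup q i)" if "Poly_Mapping.keys q \<subseteq> ?K" for q
    unfolding mdeg_def using that by (intro sum.mono_neutral_left) (auto simp: in_keys_iff)
  show ?thesis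
    using keys_add[of m n] by (simp add: aux lookup_add sum.distrib)
qed

lemma homog_mult: "homog mdeg d f \<Longrightarrow> homog mdeg e g \<Longrightarrow> homog mdeg (d + e) (f * g)"
  unfolding homog_def using keys_mult[of f g] by (force simp: mdeg_add)

lemma homog_add: "homog dg d f \<Longrightarrow> homog dg d g \<Longrightarrow> homog dg d (f + g)"
  unfolding homog_def using keys_add[of f g] by blast

lemma homog_one: "homog mdeg 0 (1 :: ('v, 'k::field) mpoly)"
  by (simp add: homog_def mdeg_def)

lemma homog_mvar: "homog mdeg 1 (mvar v :: ('v, 'k::field) mpoly)"
  by (simp add: homog_def mvar_def mdeg_def)

locale proj_scheme =
  fixes \<aa> :: "('v, 'k::field) mpoly set"
  assumes ideal_rels: "ideal \<aa> mpoly_ring"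
begin

lemma ideal_add: "f \<in> \<aa> \<Longrightarrow> g \<in> \<aa> \<Longrightarrow> f + g \<in> \<aa>"
  using additive_subgroup.a_closed[OF ideal.axioms(1)[OF ideal_rels]] by simp

lemma ideal_mult: "f \<in> \<aa> \<Longrightarrow> g * f \<in> \<aa>"
  using ideal.I_l_closed[OF ideal_rels] by simp

lemma zero_in_ideal: "0 \<in> \<aa>"
  using additive_subgroup.zero_closed[OF ideal.axioms(1)[OF ideal_rels]] by simp

lemma pt_mult:
  assumes "p \<in> proj_pts \<aa>" "f \<notin> p" "g \<notin> p"
  shows "f * g \<notin> p"
  using assms primeideal.I_prime[of p mpoly_ring f g] by (auto simp: proj_pts_def)

lemma pt_one:
  assumes "p \<in> proj_pts \<aa>"
  shows "1 \<notin> p"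
proof
  assume "1 \<in> p"
  from assms have p: "primeideal p mpoly_ring" by (simp add: proj_pts_def)
  then have "p = UNIV"
    using ideal.one_imp_carrier[OF primeideal.axioms(1)[OF p]] \<open>1 \<in> p\<close> by simp
  then show False using primeideal.I_notcarr[OF p] by simp
qed

lemma pt_mvar:
  assumes "p \<in> proj_pts \<aa>"
  obtains v where "mvar v \<notin> p"
  using assms by (auto simp: proj_pts_def)

text \<open>\<open>frac\<close> is a set for arbitrary polynomials, so admissibility of a numerator
  and denominator has to be carried separately. The degree is quantified because only the difference
  of the two degrees matters.\<close>

definition is_frac :: "('v, 'k) pt \<Rightarrow> nat \<Rightarrow> ('v, 'k) mpoly \<Rightarrow> ('v, 'k) mpoly \<Rightarrow> bool" where
  "is_frac p m a b \<longleftrightarrow> (\<exists>d. homog mdeg (d + m) a \<and> homog mdeg d b) \<and> b \<notin> p"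

lemma in_frac_iff:
  "(a', b') \<in> frac \<aa> p m a b \<longleftrightarrow>
     is_frac p m a' b' \<and> (\<exists>t e. homog mdeg e t \<and> t \<notin> p \<and> t * (a * b' - a' * b) \<in> \<aa>)"
  by (auto simp: frac_def is_frac_def)

lemma stalk_iff: "x \<in> stalk \<aa> m p \<longleftrightarrow> (\<exists>a b. is_frac p m a b \<and> x = frac \<aa> p m a b)"
  by (auto simp: stalk_def is_frac_def)

lemma stalk_cases:
  assumes "x \<in> stalk \<aa> m p"
  obtains a b where "is_frac p m a b" "x = frac \<aa> p m a b"
  using assms by (auto simp: stalk_iff)

lemma frac_in_stalk: "is_frac p m a b \<Longrightarrow> frac \<aa> p m a b \<in> stalk \<aa> m p"
  by (auto simp: stalk_iff)

context
  fixes p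
  assumes p: "p \<in> proj_pts \<aa>"
begin

lemma is_frac_mult:
  assumes "is_frac p m a b" "is_frac p n c d"
  shows "is_frac p (m + n) (a * c) (b * d)"
proof -
  obtain d1 d2 where "homog mdeg (d1 + m) a" "homog mdeg d1 b" "homog mdeg (d2 + n) c" "homog mdeg d2 d"
    using assms by (auto simp: is_frac_def)
  then have "homog mdeg (d1 + d2 + (m + n)) (a * c)" "homog mdeg (d1 + d2) (b * d)"
    using homog_mult[of "d1 + m" a "d2 + n" c] homog_mult[of d1 b d2 d] by (simp_all add: algebra_simps)
  then show ?thesis
    using assms pt_mult[OF p] by (auto simp: is_frac_def)
qed

lemma is_frac_one: "is_frac p 0 1 1"
  unfolding is_frac_def using homog_one pt_one[OF p] by (auto intro: exI[of _ 0])

lemma is_frac_add: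
  assumes "is_frac p m a b" "is_frac p m c d"
  shows "is_frac p m (a * d + c * b) (b * d)"
proof -
  obtain d1 d2 where "homog mdeg (d1 + m) a" "homog mdeg d1 b" "homog mdeg (d2 + m) c" "homog mdeg d2 d"
    using assms by (auto simp: is_frac_def)
  then have "homog mdeg (d1 + d2 + m) (a * d + c * b)" "homog mdeg (d1 + d2) (b * d)"
    using homog_mult[of "d1 + m" a d2 d] homog_mult[of "d2 + m" c d1 b] homog_mult[of d1 b d2 d]
    by (auto simp: algebra_simps intro!: homog_add)
  then show ?thesis
    using assms pt_mult[OF p] by (auto simp: is_frac_def)
qed

lemma frac_self: "is_frac p m a b \<Longrightarrow> (a, b) \<in> frac \<aa> p m a b"
  unfolding in_frac_iff using homog_one pt_one[OF p] zero_in_ideal by auto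

lemma frac_trans:
  assumes "(a', b') \<in> frac \<aa> p m a b" "(a'', b'') \<in> frac \<aa> p m a' b'"
  shows "(a'', b'') \<in> frac \<aa> p m a b"
proof -
  obtain t e s f where t: "homog mdeg e t" "t \<notin> p" "t * (a * b' - a' * b) \<in> \<aa>"
    and s: "homog mdeg f s" "s \<notin> p" "s * (a' * b'' - a'' * b') \<in> \<aa>"
    and b: "is_frac p m a' b'" "is_frac p m a'' b''"
    using assms by (auto simp: in_frac_iff)
  \<comment> \<open>Besides the two witnesses the middle denominator b' is needed as a multiplier.
    It is allowed as a witness because it is homogeneous and lies outside p.\<close>
  have "t * s * b' * (a * b'' - a'' * b)
        = s * b'' * (t * (a * b' - a' * b)) + t * b * (s * (a' * b'' - a'' * b'))"
    by (simp add: algebra_simps)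
  also have "\<dots> \<in> \<aa>" using ideal_add[OF ideal_mult[OF t(3)] ideal_mult[OF s(3)]] .
  finally have "t * s * b' * (a * b'' - a'' * b) \<in> \<aa>" .
  moreover obtain d where "homog mdeg d b'" "b' \<notin> p" using b by (auto simp: is_frac_def)
  then have "homog mdeg (e + f + d) (t * s * b')" "t * s * b' \<notin> p"
    using t s pt_mult[OF p] by (auto intro: homog_mult)
  ultimately show ?thesis
    using b(2) unfolding in_frac_iff by blast
qed

lemma frac_sym:
  assumes "(a', b') \<in> frac \<aa> p m a b" "is_frac p m a b"
  shows "(a, b) \<in> frac \<aa> p m a' b'"
proof -
  obtain t e where t: "homog mdeg e t" "t \<notin> p" "t * (a * b' - a' * b) \<in> \<aa>"
    using assms by (auto simp: in_frac_iff)
  have "t * (a' * b - a * b') = (- 1) * (t * (a * b' - a' * b))"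
    by (simp add: algebra_simps)
  also have "\<dots> \<in> \<aa>" using ideal_mult[OF t(3)] .
  finally show ?thesis using t assms(2) by (auto simp: in_frac_iff)
qed

lemma frac_eq_iff:
  assumes "is_frac p m a b" "is_frac p m a' b'"
  shows "frac \<aa> p m a b = frac \<aa> p m a' b' \<longleftrightarrow> (a', b') \<in> frac \<aa> p m a b"
proof
  assume ab: "(a', b') \<in> frac \<aa> p m a b"
  show "frac \<aa> p m a b = frac \<aa> p m a' b'"
    using frac_trans[OF ab] frac_trans[OF frac_sym[OF ab assms(1)]] by auto
qed (use frac_self[OF assms(2)] in simp)

lemma frac_eqI:
  assumes "is_frac p m a b" "is_frac p m a' b'" "homog mdeg e t" "t \<notin> p"
    and "t * (a * b' - a' * b) \<in> \<aa>"
  shows "frac \<aa> p m a b = frac \<aa> p m a' b'"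
  using assms by (subst frac_eq_iff) (auto simp: in_frac_iff)

lemma frac_eqI':
  assumes "is_frac p m a b" "is_frac p m a' b'" "a * b' = a' * b"
  shows "frac \<aa> p m a b = frac \<aa> p m a' b'"
  using assms homog_one pt_one[OF p] zero_in_ideal by (intro frac_eqI[where t = 1]) auto

text \<open>Opens the choice made inside \<open>gmult\<close> and \<open>gadd\<close>: the chosen
  pair comes with a witness that it represents the same fraction.\<close>

lemma some_in_frac:
  assumes "is_frac p m a b"
  obtains a' b' t e where "(SOME u. u \<in> frac \<aa> p m a b) = (a', b')" "is_frac p m a' b'"
    "homog mdeg e t" "t \<notin> p" "t * (a * b' - a' * b) \<in> \<aa>"
proof -
  obtain a' b' where ab: "(SOME u. u \<in> frac \<aa> p m a b) = (a', b')" by fastforce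
  have "(SOME u. u \<in> frac \<aa> p m a b) \<in> frac \<aa> p m a b"
    using frac_self[OF assms] by (rule someI)
  then show thesis using that ab by (auto simp: in_frac_iff)
qed

text \<open>Cross-multiplying the given and the chosen representatives yields a combination of the
  two witnesses of equality, so the product t * s witnesses that the choice is immaterial. Sums are
  treated in the same way below.\<close>

lemma gmult_frac:
  assumes "is_frac p 0 a b" "is_frac p m c d"
  shows "gmult \<aa> m p (frac \<aa> p 0 a b) (frac \<aa> p m c d) = frac \<aa> p m (a * c) (b * d)"
proof -
  obtain a1 b1 t e where 1: "(SOME u. u \<in> frac \<aa> p 0 a b) = (a1, b1)" "is_frac p 0 a1 b1"
    "homog mdeg e t" "t \<notin> p" "t * (a * b1 - a1 * b) \<in> \<aa>" by (rule some_in_frac[OF assms(1)])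
  obtain c1 d1 s f where 2: "(SOME u. u \<in> frac \<aa> p m c d) = (c1, d1)" "is_frac p m c1 d1"
    "homog mdeg f s" "s \<notin> p" "s * (c * d1 - c1 * d) \<in> \<aa>" by (rule some_in_frac[OF assms(2)])
  have "t * s * (a * c * (b1 * d1) - a1 * c1 * (b * d))
        = s * c * d1 * (t * (a * b1 - a1 * b)) + t * a1 * b * (s * (c * d1 - c1 * d))"
    by (simp add: algebra_simps)
  also have "\<dots> \<in> \<aa>" using ideal_add[OF ideal_mult[OF 1(5)] ideal_mult[OF 2(5)]] .
  finally have "frac \<aa> p m (a * c) (b * d) = frac \<aa> p m (a1 * c1) (b1 * d1)"
    using 1 2 assms is_frac_mult[of 0 _ _ m] pt_mult[OF p]
    by (intro frac_eqI[where t = "t * s" and e = "e + f"]) (auto intro: homog_mult)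
  then show ?thesis by (simp add: gmult_def 1 2)
qed

lemma gadd_frac:
  assumes "is_frac p m a b" "is_frac p m c d"
  shows "gadd \<aa> m p (frac \<aa> p m a b) (frac \<aa> p m c d) = frac \<aa> p m (a * d + c * b) (b * d)"
proof -
  obtain a1 b1 t e where 1: "(SOME u. u \<in> frac \<aa> p m a b) = (a1, b1)" "is_frac p m a1 b1"
    "homog mdeg e t" "t \<notin> p" "t * (a * b1 - a1 * b) \<in> \<aa>" by (rule some_in_frac[OF assms(1)])
  obtain c1 d1 s f where 2: "(SOME u. u \<in> frac \<aa> p m c d) = (c1, d1)" "is_frac p m c1 d1"
    "homog mdeg f s" "s \<notin> p" "s * (c * d1 - c1 * d) \<in> \<aa>" by (rule some_in_frac[OF assms(2)])
  have "t * s * ((a * d + c * b) * (b1 * d1) - (a1 * d1 + c1 * b1) * (b * d))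
        = s * d * d1 * (t * (a * b1 - a1 * b)) + t * b1 * b * (s * (c * d1 - c1 * d))"
    by (simp add: algebra_simps)
  also have "\<dots> \<in> \<aa>" using ideal_add[OF ideal_mult[OF 1(5)] ideal_mult[OF 2(5)]] .
  finally have "frac \<aa> p m (a * d + c * b) (b * d) = frac \<aa> p m (a1 * d1 + c1 * b1) (b1 * d1)"
    using 1 2 assms pt_mult[OF p]
    by (intro frac_eqI[where t = "t * s" and e = "e + f"]) (auto intro: homog_mult is_frac_add)
  then show ?thesis by (simp add: gadd_def 1 2)
qed

lemma gmult_closed: "x \<in> stalk \<aa> 0 p \<Longrightarrow> y \<in> stalk \<aa> m p \<Longrightarrow> gmult \<aa> m p x y \<in> stalk \<aa> m p"
  using is_frac_mult[of 0 _ _ m] by (auto elim!: stalk_cases simp: gmult_frac intro!: frac_in_stalk)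

lemma gadd_closed: "x \<in> stalk \<aa> m p \<Longrightarrow> y \<in> stalk \<aa> m p \<Longrightarrow> gadd \<aa> m p x y \<in> stalk \<aa> m p"
  by (auto elim!: stalk_cases simp: gadd_frac intro!: frac_in_stalk is_frac_add)

lemma gmult_assoc:
  "x \<in> stalk \<aa> 0 p \<Longrightarrow> y \<in> stalk \<aa> 0 p \<Longrightarrow> z \<in> stalk \<aa> m p \<Longrightarrow>
    gmult \<aa> m p (gmult \<aa> 0 p x y) z = gmult \<aa> m p x (gmult \<aa> m p y z)"
  using is_frac_mult[of 0 _ _ m] is_frac_mult[of 0 _ _ 0]
  by (auto elim!: stalk_cases simp: gmult_frac mult.assoc)

lemma gmult_comm:
  "x \<in> stalk \<aa> 0 p \<Longrightarrow> y \<in> stalk \<aa> 0 p \<Longrightarrow> gmult \<aa> 0 p x y = gmult \<aa> 0 p y x"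
  by (auto elim!: stalk_cases simp: gmult_frac mult.commute)

lemma gmult_gadd:
  assumes "x \<in> stalk \<aa> 0 p" "y \<in> stalk \<aa> m p" "z \<in> stalk \<aa> m p"
  shows "gmult \<aa> m p x (gadd \<aa> m p y z) = gadd \<aa> m p (gmult \<aa> m p x y) (gmult \<aa> m p x z)"
proof -
  obtain a b c d e f where *: "is_frac p 0 a b" "is_frac p m c d" "is_frac p m e f"
    and x: "x = frac \<aa> p 0 a b" "y = frac \<aa> p m c d" "z = frac \<aa> p m e f"
    using assms by (auto elim!: stalk_cases)
  note [simp] = is_frac_add[OF *(2,3)] is_frac_mult[OF *(1,2), simplified] is_frac_mult[OF *(1,3), simplified]
  \<comment> \<open>The two sides have denominators b * (d * f) and b * d * (b * f). They differ by
    a common factor b in numerator and denominator, and both fractions must be known to be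
    admissible.\<close>
  have "is_frac p m (a * (c * f + e * d)) (b * (d * f))"
    using is_frac_mult[OF *(1) is_frac_add[OF *(2,3)]] by simp
  moreover have "is_frac p m (a * c * (b * f) + a * e * (b * d)) (b * d * (b * f))"
    by (rule is_frac_add) simp_all
  ultimately show ?thesis
    unfolding x using * by (simp add: gmult_frac gadd_frac) (rule frac_eqI', auto simp: algebra_simps)
qed

text \<open>Packages the multiplication of the local ring because the later computation with three
  generators is a rearrangement of factors, done with the monoid's rules
  \<open>m_ac\<close>.\<close>

lemma stalk_comm_monoid:
  "comm_monoid \<lparr>carrier = stalk \<aa> 0 p, monoid.mult = gmult \<aa> 0 p, one = frac \<aa> p 0 1 1\<rparr>"
  by (rule comm_monoidI)
    (auto simp: gmult_closed gmult_assoc gmult_comm frac_in_stalk is_frac_one gmult_frac elim!: stalk_cases)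

end

end

section \<open>Sections and stalk maps\<close>

context proj_scheme
begin

section \<open>Zariski open sets and local descriptions of sections\<close>

lemma pt_mult_iff:
  assumes "p \<in> proj_pts \<aa>"
  shows "f * g \<notin> p \<longleftrightarrow> f \<notin> p \<and> g \<notin> p"
proof -
  have "ideal p mpoly_ring"
    using assms by (simp add: proj_pts_def primeideal_def)
  then show ?thesis
    using pt_mult[OF assms, of f g] ideal.I_l_closed[of p mpoly_ring g f] ideal.I_r_closed[of p mpoly_ring f g]
    by auto
qed

lemma zopen_subset: "zopen \<aa> U \<Longrightarrow> U \<subseteq> proj_pts \<aa>"
  by (auto simp: zopen_def)

lemma zopen_basic: "homog mdeg d f \<Longrightarrow> zopen \<aa> {p \<in> proj_pts \<aa>. f \<notin> p}"
  unfolding zopen_def by (rule exI[of _ "{f}"]) auto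

lemma zopen_Int:
  assumes "zopen \<aa> U" "zopen \<aa> W"
  shows "zopen \<aa> (U \<inter> W)"
proof -
  obtain F G where F: "\<forall>f\<in>F. \<exists>d. homog mdeg d f" "U = {p \<in> proj_pts \<aa>. \<not> F \<subseteq> p}"
    and G: "\<forall>f\<in>G. \<exists>d. homog mdeg d f" "W = {p \<in> proj_pts \<aa>. \<not> G \<subseteq> p}"
    using assms by (auto simp: zopen_def)
  let ?H = "{f * g |f g. f \<in> F \<and> g \<in> G}"
  have "\<forall>h\<in>?H. \<exists>d. homog mdeg d h"
    using F(1) G(1) homog_mult by blast
  moreover have "\<not> ?H \<subseteq> p \<longleftrightarrow> \<not> F \<subseteq> p \<and> \<not> G \<subseteq> p" if "p \<in> proj_pts \<aa>" for p
    using pt_mult_iff[OF that] by blast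
  then have "U \<inter> W = {p \<in> proj_pts \<aa>. \<not> ?H \<subseteq> p}"
    unfolding F(2) G(2) by blast
  ultimately show ?thesis unfolding zopen_def by blast
qed

lemma section_local:
  assumes "s \<in> sections \<aa> m U" "p \<in> U"
  obtains W a b where "zopen \<aa> W" "p \<in> W" "W \<subseteq> U"
    "\<And>q. q \<in> W \<Longrightarrow> is_frac q m a b" "\<And>q. q \<in> W \<Longrightarrow> s q = frac \<aa> q m a b"
proof -
  obtain W a b d where "zopen \<aa> W" "p \<in> W" "W \<subseteq> U" "homog mdeg (d + m) a" "homog mdeg d b"
    "\<forall>q\<in>W. b \<notin> q \<and> s q = frac \<aa> q m a b"
    using assms unfolding sections_def by blast
  then show thesis using that[of W a b] by (auto simp: is_frac_def)
qed

text \<open>A neighbourhood W that sticks out of U can be replaced by its intersection with U, so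
  the condition that W be contained in U need not be checked each time.\<close>

lemma sectionI:
  assumes ext: "s \<in> extensional U"
    and loc: "\<And>p. p \<in> U \<Longrightarrow> \<exists>W a b d. zopen \<aa> W \<and> p \<in> W \<and> homog mdeg (d + m) a \<and> homog mdeg d b \<and>
           (\<forall>q\<in>W \<inter> U. b \<notin> q \<and> s q = frac \<aa> q m a b)"
    and U: "zopen \<aa> U"
  shows "s \<in> sections \<aa> m U"
proof -
  have "\<exists>W a b d. zopen \<aa> W \<and> p \<in> W \<and> W \<subseteq> U \<and> homog mdeg (d + m) a \<and> homog mdeg d b \<and>
      (\<forall>q\<in>W. b \<notin> q \<and> s q = frac \<aa> q m a b)" if p: "p \<in> U" for p
  proof -
    obtain W a b d where W: "zopen \<aa> W" "p \<in> W" "homog mdeg (d + m) a" "homog mdeg d b"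
      "\<forall>q\<in>W \<inter> U. b \<notin> q \<and> s q = frac \<aa> q m a b"
      using loc[OF p] by metis
    show ?thesis
      using W p zopen_Int[OF W(1) U]
      by (intro exI[of _ "W \<inter> U"] exI[of _ a] exI[of _ b] exI[of _ d]) simp
  qed
  then show ?thesis using ext by (simp add: sections_def)
qed

lemma section_value: "s \<in> sections \<aa> m U \<Longrightarrow> p \<in> U \<Longrightarrow> s p \<in> stalk \<aa> m p"
  by (metis section_local frac_in_stalk)

lemma restrict_section:
  assumes "zopen \<aa> W" "W \<subseteq> U" "s \<in> sections \<aa> m U"
  shows "restrict s W \<in> sections \<aa> m W"
proof (rule sectionI)
  fix p assume "p \<in> W"
  then obtain W' a b d where "zopen \<aa> W'" "p \<in> W'" "homog mdeg (d + m) a" "homog mdeg d b"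
    "\<forall>q\<in>W'. b \<notin> q \<and> s q = frac \<aa> q m a b"
    using assms unfolding sections_def by blast
  then show "\<exists>W' a b d. zopen \<aa> W' \<and> p \<in> W' \<and> homog mdeg (d + m) a \<and> homog mdeg d b \<and>
      (\<forall>q\<in>W' \<inter> W. b \<notin> q \<and> restrict s W q = frac \<aa> q m a b)"
    by (intro exI[of _ W'] exI[of _ a] exI[of _ b] exI[of _ d]) simp
qed (use assms in auto)

lemma sections_pair_local:
  assumes "zopen \<aa> U" "s \<in> sections \<aa> m U" "p \<in> U"
    and "zopen \<aa> U'" "s' \<in> sections \<aa> n U'" "p \<in> U'"
  obtains W a b c d where "zopen \<aa> W" "p \<in> W" "W \<subseteq> U" "W \<subseteq> U'"
    "\<forall>q\<in>W. is_frac q m a b \<and> s q = frac \<aa> q m a b"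
    "\<forall>q\<in>W. is_frac q n c d \<and> s' q = frac \<aa> q n c d"
proof -
  obtain W1 a b where 1: "zopen \<aa> W1" "p \<in> W1" "W1 \<subseteq> U"
    "\<And>q. q \<in> W1 \<Longrightarrow> is_frac q m a b" "\<And>q. q \<in> W1 \<Longrightarrow> s q = frac \<aa> q m a b"
    using section_local[OF assms(2,3)] by metis
  obtain W2 c d where 2: "zopen \<aa> W2" "p \<in> W2" "W2 \<subseteq> U'"
    "\<And>q. q \<in> W2 \<Longrightarrow> is_frac q n c d" "\<And>q. q \<in> W2 \<Longrightarrow> s' q = frac \<aa> q n c d"
    using section_local[OF assms(5,6)] by metis
  have "W1 \<inter> W2 \<subseteq> U" "W1 \<inter> W2 \<subseteq> U'" using 1(3) 2(3) by auto
  from that[OF zopen_Int[OF 1(1) 2(1)] _ this, of a b c d] show thesis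
    using 1(2,4,5) 2(2,4,5) by blast
qed

lemma sections_gmult:
  assumes U: "zopen \<aa> U" and s: "s \<in> sections \<aa> 0 U" and t: "t \<in> sections \<aa> 0 U"
  shows "restrict (\<lambda>p. gmult \<aa> 0 p (s p) (t p)) U \<in> sections \<aa> 0 U"
proof (rule sectionI)
  fix p assume p: "p \<in> U"
  obtain W a b c d where W: "zopen \<aa> W" "p \<in> W" "W \<subseteq> U"
    "\<forall>q\<in>W. is_frac q 0 a b \<and> s q = frac \<aa> q 0 a b"
    "\<forall>q\<in>W. is_frac q 0 c d \<and> t q = frac \<aa> q 0 c d"
    by (rule sections_pair_local[OF U s p U t p])
  have E: "q \<in> proj_pts \<aa>" if "q \<in> W" for q using that W(1) zopen_subset by blast
  have *: "is_frac q 0 (a * c) (b * d)" if "q \<in> W" for q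
    using is_frac_mult[OF E[OF that], of 0 a b 0 c d] W(4,5) that by simp
  obtain e where "homog mdeg (e + 0) (a * c)" "homog mdeg e (b * d)"
    using *[OF W(2)] by (auto simp: is_frac_def)
  moreover have "b * d \<notin> q \<and> restrict (\<lambda>p. gmult \<aa> 0 p (s p) (t p)) U q = frac \<aa> q 0 (a * c) (b * d)"
    if "q \<in> W \<inter> U" for q
  proof -
    have "b * d \<notin> q" using *[of q] that by (auto simp: is_frac_def)
    then show ?thesis using W(4,5) that gmult_frac[OF E, of q a b 0 c d] by simp
  qed
  ultimately show "\<exists>W a b d. zopen \<aa> W \<and> p \<in> W \<and> homog mdeg (d + 0) a \<and> homog mdeg d b \<and>
      (\<forall>q\<in>W \<inter> U. b \<notin> q \<and> restrict (\<lambda>p. gmult \<aa> 0 p (s p) (t p)) U q = frac \<aa> q 0 a b)"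
    using W(1,2) by blast
qed (use U in auto)

lemma sections_gadd:
  assumes U: "zopen \<aa> U" and s: "s \<in> sections \<aa> 0 U" and t: "t \<in> sections \<aa> 0 U"
  shows "restrict (\<lambda>p. gadd \<aa> 0 p (s p) (t p)) U \<in> sections \<aa> 0 U"
proof (rule sectionI)
  fix p assume p: "p \<in> U"
  obtain W a b c d where W: "zopen \<aa> W" "p \<in> W" "W \<subseteq> U"
    "\<forall>q\<in>W. is_frac q 0 a b \<and> s q = frac \<aa> q 0 a b"
    "\<forall>q\<in>W. is_frac q 0 c d \<and> t q = frac \<aa> q 0 c d"
    by (rule sections_pair_local[OF U s p U t p])
  have E: "q \<in> proj_pts \<aa>" if "q \<in> W" for q using that W(1) zopen_subset by blast
  have *: "is_frac q 0 (a * d + c * b) (b * d)" if "q \<in> W" for q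
    using is_frac_add[OF E[OF that], of 0 a b c d] W(4,5) that by simp
  obtain e where "homog mdeg (e + 0) (a * d + c * b)" "homog mdeg e (b * d)"
    using *[OF W(2)] by (auto simp: is_frac_def)
  moreover have "b * d \<notin> q \<and> restrict (\<lambda>p. gadd \<aa> 0 p (s p) (t p)) U q = frac \<aa> q 0 (a * d + c * b) (b * d)"
    if "q \<in> W \<inter> U" for q
  proof -
    have "b * d \<notin> q" using *[of q] that by (auto simp: is_frac_def)
    then show ?thesis using W(4,5) that gadd_frac[OF E, of q 0 a b c d] by simp
  qed
  ultimately show "\<exists>W a b d. zopen \<aa> W \<and> p \<in> W \<and> homog mdeg (d + 0) a \<and> homog mdeg d b \<and>
      (\<forall>q\<in>W \<inter> U. b \<notin> q \<and> restrict (\<lambda>p. gadd \<aa> 0 p (s p) (t p)) U q = frac \<aa> q 0 a b)"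
    using W(1,2) by blast
qed (use U in auto)

lemma section_of_stalk:
  assumes "p \<in> proj_pts \<aa>" "x \<in> stalk \<aa> m p"
  obtains U s where "zopen \<aa> U" "p \<in> U" "s \<in> sections \<aa> m U" "s p = x"
proof -
  \<comment> \<open>A germ a/b extends to the basic open set on which b does not vanish.\<close>
  obtain a b d where ab: "homog mdeg (d + m) a" "homog mdeg d b" "b \<notin> p" "x = frac \<aa> p m a b"
    using assms(2) by (auto simp: stalk_def)
  let ?U = "{q \<in> proj_pts \<aa>. b \<notin> q}"
  have U: "zopen \<aa> ?U" using ab zopen_basic by blast
  have "restrict (\<lambda>q. frac \<aa> q m a b) ?U \<in> sections \<aa> m ?U"
  proof (rule sectionI)
    fix q assume "q \<in> ?U"
    then show "\<exists>W a' b' d. zopen \<aa> W \<and> q \<in> W \<and> homog mdeg (d + m) a' \<and> homog mdeg d b' \<and>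
        (\<forall>q\<in>W \<inter> ?U. b' \<notin> q \<and> restrict (\<lambda>q. frac \<aa> q m a b) ?U q = frac \<aa> q m a' b')"
      using ab(1,2) U by (intro exI[of _ ?U] exI[of _ a] exI[of _ b] exI[of _ d]) simp
  qed (use U in auto)
  then show thesis using that[OF U] ab assms(1) by auto
qed

text \<open>The witness t for the equality of two fractions at p is a witness at every q with t
  outside q as well, so equality at one point spreads to an open neighbourhood.\<close>

lemma sections_agree_near:
  assumes "zopen \<aa> U" "s \<in> sections \<aa> m U" "p \<in> U"
    and "zopen \<aa> U'" "s' \<in> sections \<aa> m U'" "p \<in> U'"
    and "s p = s' p"
  obtains W where "zopen \<aa> W" "p \<in> W" "W \<subseteq> U" "W \<subseteq> U'" "restrict s W = restrict s' W"
proof -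
  obtain W a b c d where W: "zopen \<aa> W" "p \<in> W" "W \<subseteq> U" "W \<subseteq> U'"
    "\<forall>q\<in>W. is_frac q m a b \<and> s q = frac \<aa> q m a b"
    "\<forall>q\<in>W. is_frac q m c d \<and> s' q = frac \<aa> q m c d"
    by (rule sections_pair_local[OF assms(1-6)])
  have p: "p \<in> proj_pts \<aa>" using assms zopen_subset by blast
  have "frac \<aa> p m a b = frac \<aa> p m c d" using W(2,5,6) assms(7) by metis
  then obtain t e where t: "homog mdeg e t" "t \<notin> p" "t * (a * d - c * b) \<in> \<aa>"
    using frac_eq_iff[OF p, of m a b c d] W(2,5,6) by (auto simp: in_frac_iff)
  let ?W = "W \<inter> {q \<in> proj_pts \<aa>. t \<notin> q}"
  have "s q = s' q" if "q \<in> ?W" for q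
    using that W(5,6) t by (simp add: frac_eqI[of q m a b c d e t])
  then have "restrict s ?W = restrict s' ?W" by (rule restrict_ext)
  moreover have "?W \<subseteq> U" "?W \<subseteq> U'" "p \<in> ?W" using W(2,3,4) p t by auto
  ultimately show thesis
    using that zopen_Int[OF W(1) zopen_basic[OF t(1)]] by blast
qed

text \<open>The properties of \<open>scheme_aut\<close> on which stalk maps rest, in a form that
  passes to the identity and to composites and so to all powers of \<sigma>.\<close>

definition scheme_end :: "('v, 'k) scheme_map \<Rightarrow> bool" where
  "scheme_end \<tau> \<longleftrightarrow> (\<forall>p\<in>proj_pts \<aa>. on_pts \<tau> p \<in> proj_pts \<aa>) \<and>
     (\<forall>U. zopen \<aa> U \<longrightarrow> zopen \<aa> (preim \<aa> \<tau> U) \<and>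
        comorph \<tau> U \<in> ring_hom (structure_ring \<aa> U) (structure_ring \<aa> (preim \<aa> \<tau> U)) \<and>
        (\<forall>W s. zopen \<aa> W \<and> W \<subseteq> U \<and> s \<in> sections \<aa> 0 U \<longrightarrow>
           comorph \<tau> W (restrict s W) = restrict (comorph \<tau> U s) (preim \<aa> \<tau> W)))"

context
  fixes \<tau>
  assumes \<tau>: "scheme_end \<tau>"
begin

lemma on_pts_closed: "p \<in> proj_pts \<aa> \<Longrightarrow> on_pts \<tau> p \<in> proj_pts \<aa>"
  using \<tau> by (simp add: scheme_end_def)

lemma zopen_preim: "zopen \<aa> U \<Longrightarrow> zopen \<aa> (preim \<aa> \<tau> U)"
  using \<tau> by (simp add: scheme_end_def)

lemma comorph_hom:
  "zopen \<aa> U \<Longrightarrow> comorph \<tau> U \<in> ring_hom (structure_ring \<aa> U) (structure_ring \<aa> (preim \<aa> \<tau> U))"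
  using \<tau> by (simp add: scheme_end_def)

lemma comorph_restrict:
  "zopen \<aa> U \<Longrightarrow> zopen \<aa> W \<Longrightarrow> W \<subseteq> U \<Longrightarrow> s \<in> sections \<aa> 0 U \<Longrightarrow>
    comorph \<tau> W (restrict s W) = restrict (comorph \<tau> U s) (preim \<aa> \<tau> W)"
  using \<tau> by (simp add: scheme_end_def)

lemma comorph_section: "zopen \<aa> U \<Longrightarrow> s \<in> sections \<aa> 0 U \<Longrightarrow> comorph \<tau> U s \<in> sections \<aa> 0 (preim \<aa> \<tau> U)"
  using ring_hom_closed[OF comorph_hom, of U s] by (simp add: structure_ring_def)

context
  fixes p
  assumes p: "p \<in> proj_pts \<aa>"
begin

text \<open>Two sections with the same germ at \<open>on_pts \<tau> p\<close> agree on some open W,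
  and \<open>comorph \<tau>\<close> commutes with restriction to W. Hence all candidates in the
  choice that defines \<open>stalk_map\<close> coincide.\<close>

lemma stalk_map_eq:
  assumes U: "zopen \<aa> U" "on_pts \<tau> p \<in> U" and s: "s \<in> sections \<aa> 0 U"
  shows "stalk_map \<aa> \<tau> p (s (on_pts \<tau> p)) = comorph \<tau> U s p"
  unfolding stalk_map_def
proof (rule some_equality)
  fix h
  assume "\<exists>U' s'. zopen \<aa> U' \<and> on_pts \<tau> p \<in> U' \<and> s' \<in> sections \<aa> 0 U' \<and>
    s' (on_pts \<tau> p) = s (on_pts \<tau> p) \<and> h = comorph \<tau> U' s' p"
  then obtain U' s' where U': "zopen \<aa> U'" "on_pts \<tau> p \<in> U'" "s' \<in> sections \<aa> 0 U'"
    "s (on_pts \<tau> p) = s' (on_pts \<tau> p)" "h = comorph \<tau> U' s' p" by auto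
  obtain W where W: "zopen \<aa> W" "on_pts \<tau> p \<in> W" "W \<subseteq> U" "W \<subseteq> U'" "restrict s W = restrict s' W"
    by (rule sections_agree_near[OF U(1) s U(2) U'(1,3,2,4)])
  have pW: "p \<in> preim \<aa> \<tau> W" using W(2) p by (simp add: preim_def)
  have "h = restrict (comorph \<tau> U' s') (preim \<aa> \<tau> W) p" using pW U'(5) by simp
  also have "\<dots> = restrict (comorph \<tau> U s) (preim \<aa> \<tau> W) p"
    using comorph_restrict[OF U(1) W(1,3) s] comorph_restrict[OF U'(1) W(1,4) U'(3)] W(5) by simp
  finally show "h = comorph \<tau> U s p" using pW by simp
qed (use assms in blast)

lemma stalk_map_closed:
  assumes "x \<in> stalk \<aa> 0 (on_pts \<tau> p)"
  shows "stalk_map \<aa> \<tau> p x \<in> stalk \<aa> 0 p"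
proof -
  obtain U s where U: "zopen \<aa> U" "on_pts \<tau> p \<in> U" "s \<in> sections \<aa> 0 U" "s (on_pts \<tau> p) = x"
    using section_of_stalk[OF on_pts_closed[OF p] assms] by metis
  then show ?thesis
    using stalk_map_eq section_value[OF comorph_section[OF U(1,3)], of p] p by (auto simp: preim_def)
qed

text \<open>Both germs have to be realized over the same open set, since additivity and
  multiplicativity of \<open>comorph \<tau>\<close> are available one structure ring at a
  time.\<close>

lemma stalk_map_pair:
  assumes "x \<in> stalk \<aa> 0 (on_pts \<tau> p)" "y \<in> stalk \<aa> 0 (on_pts \<tau> p)"
  obtains U s t where "zopen \<aa> U" "on_pts \<tau> p \<in> U" "p \<in> preim \<aa> \<tau> U" "s \<in> sections \<aa> 0 U" "t \<in> sections \<aa> 0 U"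
    "s (on_pts \<tau> p) = x" "t (on_pts \<tau> p) = y"
proof -
  obtain U s where U: "zopen \<aa> U" "on_pts \<tau> p \<in> U" "s \<in> sections \<aa> 0 U" "s (on_pts \<tau> p) = x"
    using section_of_stalk[OF on_pts_closed[OF p] assms(1)] by metis
  obtain W t where W: "zopen \<aa> W" "on_pts \<tau> p \<in> W" "t \<in> sections \<aa> 0 W" "t (on_pts \<tau> p) = y"
    using section_of_stalk[OF on_pts_closed[OF p] assms(2)] by metis
  note UW = zopen_Int[OF U(1) W(1)]
  show thesis
    using that[OF UW _ _ restrict_section[OF UW _ U(3)] restrict_section[OF UW _ W(3)]] U(2,4) W(2,4) p
    by (simp add: preim_def)
qed

lemma stalk_map_gmult:
  assumes "x \<in> stalk \<aa> 0 (on_pts \<tau> p)" "y \<in> stalk \<aa> 0 (on_pts \<tau> p)"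
  shows "stalk_map \<aa> \<tau> p (gmult \<aa> 0 (on_pts \<tau> p) x y)
    = gmult \<aa> 0 p (stalk_map \<aa> \<tau> p x) (stalk_map \<aa> \<tau> p y)"
proof -
  obtain U s t where U: "zopen \<aa> U" "on_pts \<tau> p \<in> U" "p \<in> preim \<aa> \<tau> U"
    and s: "s \<in> sections \<aa> 0 U" "t \<in> sections \<aa> 0 U" "s (on_pts \<tau> p) = x" "t (on_pts \<tau> p) = y"
    by (rule stalk_map_pair[OF assms])
  let ?st = "s \<otimes>\<^bsub>structure_ring \<aa> U\<^esub> t"
  have st: "?st (on_pts \<tau> p) = gmult \<aa> 0 (on_pts \<tau> p) x y"
    using U s by (simp add: structure_ring_def)
  have "?st \<in> sections \<aa> 0 U"
    using sections_gmult[OF U(1) s(1,2)] by (simp add: structure_ring_def)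
  then show ?thesis
    using stalk_map_eq[OF U(1,2), of ?st] stalk_map_eq[OF U(1,2) s(1)] stalk_map_eq[OF U(1,2) s(2)]
      ring_hom_mult[OF comorph_hom[OF U(1)], of s t] U s st by (simp add: structure_ring_def)
qed

lemma stalk_map_gadd:
  assumes "x \<in> stalk \<aa> 0 (on_pts \<tau> p)" "y \<in> stalk \<aa> 0 (on_pts \<tau> p)"
  shows "stalk_map \<aa> \<tau> p (gadd \<aa> 0 (on_pts \<tau> p) x y)
    = gadd \<aa> 0 p (stalk_map \<aa> \<tau> p x) (stalk_map \<aa> \<tau> p y)"
proof -
  obtain U s t where U: "zopen \<aa> U" "on_pts \<tau> p \<in> U" "p \<in> preim \<aa> \<tau> U"
    and s: "s \<in> sections \<aa> 0 U" "t \<in> sections \<aa> 0 U" "s (on_pts \<tau> p) = x" "t (on_pts \<tau> p) = y"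
    by (rule stalk_map_pair[OF assms])
  let ?st = "s \<oplus>\<^bsub>structure_ring \<aa> U\<^esub> t"
  have st: "?st (on_pts \<tau> p) = gadd \<aa> 0 (on_pts \<tau> p) x y"
    using U s by (simp add: structure_ring_def)
  have "?st \<in> sections \<aa> 0 U"
    using sections_gadd[OF U(1) s(1,2)] by (simp add: structure_ring_def)
  then show ?thesis
    using stalk_map_eq[OF U(1,2), of ?st] stalk_map_eq[OF U(1,2) s(1)] stalk_map_eq[OF U(1,2) s(2)]
      ring_hom_add[OF comorph_hom[OF U(1)], of s t] U s st by (simp add: structure_ring_def)
qed

end

end

text \<open>\<open>preim\<close> keeps only points of E, so the right-hand side also asks the
  intermediate image of a point to lie in E; this is what the assumption provides.\<close>

lemma preim_aut_pow_Suc: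
  assumes "\<And>p. p \<in> proj_pts \<aa> \<Longrightarrow> on_pts (aut_pow \<aa> \<sigma> k) p \<in> proj_pts \<aa>"
  shows "preim \<aa> (aut_pow \<aa> \<sigma> (Suc k)) U = preim \<aa> (aut_pow \<aa> \<sigma> k) (preim \<aa> \<sigma> U)"
  using assms by (auto simp: preim_def)

lemma on_pts_aut_pow_add:
  "on_pts (aut_pow \<aa> \<sigma> k) (on_pts (aut_pow \<aa> \<sigma> i) p) = on_pts (aut_pow \<aa> \<sigma> (i + k)) p"
  by (induction k) simp_all

lemma stalk_map_id:
  assumes "p \<in> proj_pts \<aa>" "x \<in> stalk \<aa> 0 p"
  shows "stalk_map \<aa> (aut_pow \<aa> \<sigma> 0) p x = x"
proof -
  obtain U s where "zopen \<aa> U" "p \<in> U" "s \<in> sections \<aa> 0 U" "s p = x"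
    using section_of_stalk[OF assms] by metis
  then show ?thesis
    unfolding stalk_map_def by (intro some_equality) auto
qed

end

section \<open>Powers of the automorphism and their stalk maps\<close>

locale proj_scheme_aut = proj_scheme \<aa> for \<aa> :: "('v, 'k::field) mpoly set" +
  fixes \<sigma> :: "('v, 'k) scheme_map"
  assumes aut: "scheme_aut \<aa> \<sigma>"
begin

lemma scheme_end_aut: "scheme_end \<sigma>"
proof -
  have "zopen \<aa> (preim \<aa> \<sigma> U)" if "zopen \<aa> U" for U
    using aut zopen_subset[OF that] that by (auto simp: scheme_aut_def)
  then show ?thesis
    using aut unfolding scheme_end_def scheme_aut_def ring_iso_def by (auto dest: bij_betwE)
qed

lemma scheme_end_pow: "scheme_end (aut_pow \<aa> \<sigma> k)"
proof (induction k)
  case 0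
  \<comment> \<open>The preimage under the identity is U cut down to the points of E, which is U
    itself because open sets consist of such points.\<close>
  have "preim \<aa> (aut_pow \<aa> \<sigma> 0) U = U" if "zopen \<aa> U" for U
    using zopen_subset[OF that] by (auto simp: preim_def)
  then show ?case by (auto simp: scheme_end_def ring_hom_def)
next
  case (Suc k)
  have pre: "preim \<aa> (aut_pow \<aa> \<sigma> (Suc k)) U = preim \<aa> (aut_pow \<aa> \<sigma> k) (preim \<aa> \<sigma> U)" for U
    by (rule preim_aut_pow_Suc) (rule on_pts_closed[OF Suc.IH])
  show ?case
    unfolding scheme_end_def
  proof (intro conjI allI impI ballI)
    fix p assume "p \<in> proj_pts \<aa>"
    then show "on_pts (aut_pow \<aa> \<sigma> (Suc k)) p \<in> proj_pts \<aa>"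
      using on_pts_closed[OF Suc.IH] on_pts_closed[OF scheme_end_aut] by simp
  next
    fix U assume U: "zopen \<aa> U"
    note U' = zopen_preim[OF scheme_end_aut U]
    show "zopen \<aa> (preim \<aa> (aut_pow \<aa> \<sigma> (Suc k)) U)"
      unfolding pre using zopen_preim[OF Suc.IH U'] .
    show "comorph (aut_pow \<aa> \<sigma> (Suc k)) U
        \<in> ring_hom (structure_ring \<aa> U) (structure_ring \<aa> (preim \<aa> (aut_pow \<aa> \<sigma> (Suc k)) U))"
      unfolding pre using ring_hom_trans[OF comorph_hom[OF scheme_end_aut U] comorph_hom[OF Suc.IH U']] by simp
    fix W s assume W: "zopen \<aa> W \<and> W \<subseteq> U \<and> s \<in> sections \<aa> 0 U"
    then have W': "zopen \<aa> W" "W \<subseteq> U" and s: "s \<in> sections \<aa> 0 U" by auto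
    have "preim \<aa> \<sigma> W \<subseteq> preim \<aa> \<sigma> U" using W' by (auto simp: preim_def)
    then show "comorph (aut_pow \<aa> \<sigma> (Suc k)) W (restrict s W)
        = restrict (comorph (aut_pow \<aa> \<sigma> (Suc k)) U s) (preim \<aa> (aut_pow \<aa> \<sigma> (Suc k)) W)"
      unfolding pre using comorph_restrict[OF scheme_end_aut U W' s]
        comorph_restrict[OF Suc.IH U' zopen_preim[OF scheme_end_aut W'(1)] _ comorph_section[OF scheme_end_aut U s]]
      by simp
  qed
qed

lemma comorph_pow_add:
  "comorph (aut_pow \<aa> \<sigma> (i + k)) U
    = comorph (aut_pow \<aa> \<sigma> i) (preim \<aa> (aut_pow \<aa> \<sigma> k) U) \<circ> comorph (aut_pow \<aa> \<sigma> k) U" if "zopen \<aa> U"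
  using that
proof (induction k arbitrary: U)
  case 0
  have "preim \<aa> (aut_pow \<aa> \<sigma> 0) U = U"
    using zopen_subset[OF 0] by (auto simp: preim_def)
  then show ?case by simp
next
  case (Suc k)
  show ?case
    using Suc.IH[OF zopen_preim[OF scheme_end_aut Suc.prems]]
      preim_aut_pow_Suc[OF on_pts_closed[OF scheme_end_pow], of k U] by (simp add: comp_assoc)
qed

text \<open>Pulling a section back along \<sigma> to the power k gives a section near the i-th
  iterate of p, which can be pulled back again. This is needed for a scaling relation in the second
  factor of a product, where the coefficient reaches p in these two stages.\<close>

lemma stalk_map_comp:
  assumes p: "p \<in> proj_pts \<aa>" and x: "x \<in> stalk \<aa> 0 (on_pts (aut_pow \<aa> \<sigma> (i + k)) p)"
  shows "stalk_map \<aa> (aut_pow \<aa> \<sigma> i) p (stalk_map \<aa> (aut_pow \<aa> \<sigma> k) (on_pts (aut_pow \<aa> \<sigma> i) p) x)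
    = stalk_map \<aa> (aut_pow \<aa> \<sigma> (i + k)) p x"
proof -
  let ?q = "on_pts (aut_pow \<aa> \<sigma> i) p"
  have q: "?q \<in> proj_pts \<aa>" by (rule on_pts_closed[OF scheme_end_pow p])
  obtain U s where U: "zopen \<aa> U" "on_pts (aut_pow \<aa> \<sigma> (i + k)) p \<in> U" "s \<in> sections \<aa> 0 U"
    "s (on_pts (aut_pow \<aa> \<sigma> (i + k)) p) = x"
    using section_of_stalk[OF on_pts_closed[OF scheme_end_pow p] x] by metis
  have "?q \<in> preim \<aa> (aut_pow \<aa> \<sigma> k) U"
    using q U(2) by (simp add: preim_def on_pts_aut_pow_add)
  note 1 = stalk_map_eq[OF scheme_end_pow p zopen_preim[OF scheme_end_pow U(1)] this
      comorph_section[OF scheme_end_pow U(1,3)]]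
  have 2: "stalk_map \<aa> (aut_pow \<aa> \<sigma> k) ?q x = comorph (aut_pow \<aa> \<sigma> k) U s ?q"
    using stalk_map_eq[OF scheme_end_pow[of k] q U(1) _ U(3)] U(2,4) by (simp add: on_pts_aut_pow_add)
  show ?thesis
    using 1 2 stalk_map_eq[OF scheme_end_pow p U(1,2,3)] U(4) comorph_pow_add[OF U(1), of i k] by simp
qed

end

section \<open>The stalks of the sheaves \<open>\<L>\<^sub>d\<close>\<close>

lemma additive_span_uminus:
  assumes "x \<in> additive_span G"
  shows "- x \<in> additive_span G"
  using additive_span.diff[OF additive_span.zero assms] by simp

lemma additive_span_add:
  assumes "x \<in> additive_span G" "y \<in> additive_span G"
  shows "x + y \<in> additive_span G"
  using additive_span.diff[OF assms(1) additive_span_uminus[OF assms(2)]] by simp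

lemma additive_span_sum: "(\<And>x. x \<in> A \<Longrightarrow> f x \<in> additive_span G) \<Longrightarrow> sum f A \<in> additive_span G"
  by (induction A rule: infinite_finite_induct) (auto intro: additive_span.zero additive_span_add)

lemma additive_span_subset:
  assumes "G \<subseteq> additive_span G'"
  shows "additive_span G \<subseteq> additive_span G'"
proof
  fix x assume "x \<in> additive_span G"
  then show "x \<in> additive_span G'"
    using assms by induction (auto intro: additive_span.zero additive_span.diff)
qed

lemma tclass_eq_iff:
  "tclass \<aa> \<sigma> d p t = tclass \<aa> \<sigma> d p t' \<longleftrightarrow> t - t' \<in> additive_span (tensor_rels \<aa> \<sigma> d p)"
proof
  assume "tclass \<aa> \<sigma> d p t = tclass \<aa> \<sigma> d p t'"
  moreover have "t \<in> tclass \<aa> \<sigma> d p t" by (simp add: tclass_def additive_span.zero)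
  ultimately have "t \<in> tclass \<aa> \<sigma> d p t'" by simp
  then show "t - t' \<in> additive_span (tensor_rels \<aa> \<sigma> d p)" by (simp add: tclass_def)
next
  assume *: "t - t' \<in> additive_span (tensor_rels \<aa> \<sigma> d p)"
  show "tclass \<aa> \<sigma> d p t = tclass \<aa> \<sigma> d p t'"
    using additive_span_add[OF _ *] additive_span.diff[OF _ *] by (force simp: tclass_def)
qed

lemma some_in_tclass:
  "(SOME u. u \<in> tclass \<aa> \<sigma> d p t) - t \<in> additive_span (tensor_rels \<aa> \<sigma> d p)"
proof -
  have "t \<in> tclass \<aa> \<sigma> d p t" by (simp add: tclass_def additive_span.zero)
  then have "(SOME u. u \<in> tclass \<aa> \<sigma> d p t) \<in> tclass \<aa> \<sigma> d p t" by (rule someI)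
  then show ?thesis by (simp add: tclass_def)
qed

text \<open>The assumption forces \<open>F x 0 = 0\<close>, so all three sums may be taken over the
  union of the key sets. This yields biadditivity of \<open>tmult\<close>, whose range of summation
  changes with its arguments.\<close>

lemma sum_keys_diff:
  fixes F :: "'a \<Rightarrow> int \<Rightarrow> 'b::ab_group_add"
  assumes "\<And>x a b. F x (a - b) = F x a - F x b"
  shows "(\<Sum>x\<in>Poly_Mapping.keys (s - t). F x (Poly_Mapping.lookup (s - t) x))
    = (\<Sum>x\<in>Poly_Mapping.keys s. F x (Poly_Mapping.lookup s x))
      - (\<Sum>x\<in>Poly_Mapping.keys t. F x (Poly_Mapping.lookup t x))"
proof -
  let ?K = "Poly_Mapping.keys s \<union> Poly_Mapping.keys t"
  have 0: "F x 0 = 0" for x using assms[of x 0 0] by simp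
  have aux: "(\<Sum>x\<in>Poly_Mapping.keys q. F x (Poly_Mapping.lookup q x)) = (\<Sum>x\<in>?K. F x (Poly_Mapping.lookup q x))"
    if "Poly_Mapping.keys q \<subseteq> ?K" for q
    using that by (intro sum.mono_neutral_left) (auto simp: in_keys_iff 0)
  show ?thesis
    by (subst aux[OF keys_diff]) (simp add: aux lookup_minus assms sum_subtractf)
qed

lemma tmult_alt:
  "tmult \<aa> \<sigma> i p t t' = (\<Sum>x\<in>Poly_Mapping.keys t. \<Sum>y\<in>Poly_Mapping.keys t'.
     Poly_Mapping.single (gmult \<aa> 0 p (fst x) (stalk_map \<aa> (aut_pow \<aa> \<sigma> i) p (fst y)), snd x @ snd y)
       (Poly_Mapping.lookup t x * Poly_Mapping.lookup t' y))"
  unfolding tmult_def by (intro sum.cong refl) (simp add: case_prod_beta)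

lemma tmult_diff_left: "tmult \<aa> \<sigma> i p (s - t) u = tmult \<aa> \<sigma> i p s u - tmult \<aa> \<sigma> i p t u"
  unfolding tmult_alt
  by (rule sum_keys_diff) (simp add: left_diff_distrib single_diff sum_subtractf)

lemma tmult_diff_right: "tmult \<aa> \<sigma> i p u (s - t) = tmult \<aa> \<sigma> i p u s - tmult \<aa> \<sigma> i p u t"
  unfolding tmult_alt sum_subtractf[symmetric]
  by (intro sum.cong refl sum_keys_diff) (simp add: right_diff_distrib single_diff)

lemma tmult_zero_left [simp]: "tmult \<aa> \<sigma> i p 0 u = 0"
  and tmult_zero_right [simp]: "tmult \<aa> \<sigma> i p u 0 = 0"
  by (simp_all add: tmult_alt)

lemma tmult_single:
  "tmult \<aa> \<sigma> i p (Poly_Mapping.single (r, ms) 1) (Poly_Mapping.single (r', ms') 1)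
    = Poly_Mapping.single (gmult \<aa> 0 p r (stalk_map \<aa> (aut_pow \<aa> \<sigma> i) p r'), ms @ ms') 1"
  by (simp add: tmult_alt)

text \<open>By biadditivity, membership need only be checked on generators. It is used for symbols
  times symbols, relations times symbols, and symbols times relations.\<close>

lemma tmult_span:
  assumes "\<And>x y. x \<in> G \<Longrightarrow> y \<in> G' \<Longrightarrow> tmult \<aa> \<sigma> i p x y \<in> additive_span S"
    and t: "t \<in> additive_span G" and t': "t' \<in> additive_span G'"
  shows "tmult \<aa> \<sigma> i p t t' \<in> additive_span S"
  using t
proof induction
  case (base x)
  show ?case using t'
    by induction (auto simp: tmult_diff_right intro: assms(1) base additive_span.zero additive_span.diff)
qed (auto simp: tmult_diff_left intro: additive_span.zero additive_span.diff)

lemma symbols_iff: "(r, ms) \<in> symbols \<aa> \<sigma> d p \<longleftrightarrow> r \<in> stalk \<aa> 0 p \<and> length ms = d \<and>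
    (\<forall>k<d. ms ! k \<in> stalk \<aa> 1 (on_pts (aut_pow \<aa> \<sigma> k) p))"
  by (simp add: symbols_def)

lemma rel_add_coeff:
  assumes "(r, ms) \<in> symbols \<aa> \<sigma> d p" "(r', ms) \<in> symbols \<aa> \<sigma> d p"
  shows "Poly_Mapping.single (gadd \<aa> 0 p r r', ms) 1 - Poly_Mapping.single (r, ms) 1
    - Poly_Mapping.single (r', ms) 1 \<in> tensor_rels \<aa> \<sigma> d p"
  using assms unfolding tensor_rels_def by blast

lemma rel_add_slot:
  assumes "k < d" "(r, ms[k := x]) \<in> symbols \<aa> \<sigma> d p" "(r, ms[k := y]) \<in> symbols \<aa> \<sigma> d p"
  shows "Poly_Mapping.single (r, ms[k := gadd \<aa> 1 (on_pts (aut_pow \<aa> \<sigma> k) p) x y]) 1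
    - Poly_Mapping.single (r, ms[k := x]) 1 - Poly_Mapping.single (r, ms[k := y]) 1 \<in> tensor_rels \<aa> \<sigma> d p"
  using assms unfolding tensor_rels_def by blast

lemma rel_scale:
  assumes "k < d" "(r, ms) \<in> symbols \<aa> \<sigma> d p" "a \<in> stalk \<aa> 0 (on_pts (aut_pow \<aa> \<sigma> k) p)"
  shows "Poly_Mapping.single (gmult \<aa> 0 p r (stalk_map \<aa> (aut_pow \<aa> \<sigma> k) p a), ms) 1
    - Poly_Mapping.single (r, ms[k := gmult \<aa> 1 (on_pts (aut_pow \<aa> \<sigma> k) p) a (ms ! k)]) 1 \<in> tensor_rels \<aa> \<sigma> d p"
  using assms unfolding tensor_rels_def by blast

lemma tensor_rels_cases:
  assumes "t \<in> tensor_rels \<aa> \<sigma> d p"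
  obtains (add_coeff) r r' ms where "(r, ms) \<in> symbols \<aa> \<sigma> d p" "(r', ms) \<in> symbols \<aa> \<sigma> d p"
      "t = Poly_Mapping.single (gadd \<aa> 0 p r r', ms) 1 - Poly_Mapping.single (r, ms) 1
        - Poly_Mapping.single (r', ms) 1"
  | (add_slot) r ms k x y where "k < d" "(r, ms[k := x]) \<in> symbols \<aa> \<sigma> d p" "(r, ms[k := y]) \<in> symbols \<aa> \<sigma> d p"
      "t = Poly_Mapping.single (r, ms[k := gadd \<aa> 1 (on_pts (aut_pow \<aa> \<sigma> k) p) x y]) 1
        - Poly_Mapping.single (r, ms[k := x]) 1 - Poly_Mapping.single (r, ms[k := y]) 1"
  | (scale) r ms k a where "k < d" "(r, ms) \<in> symbols \<aa> \<sigma> d p" "a \<in> stalk \<aa> 0 (on_pts (aut_pow \<aa> \<sigma> k) p)"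
      "t = Poly_Mapping.single (gmult \<aa> 0 p r (stalk_map \<aa> (aut_pow \<aa> \<sigma> k) p a), ms) 1
        - Poly_Mapping.single (r, ms[k := gmult \<aa> 1 (on_pts (aut_pow \<aa> \<sigma> k) p) a (ms ! k)]) 1"
  using assms unfolding tensor_rels_def by blast

context proj_scheme_aut
begin

text \<open>\<open>tmult\<close> respects the tensor relations only on combinations of genuine symbols, so
  representatives must be tracked in \<open>symbol_span\<close>.\<close>

abbreviation "iter \<equiv> \<lambda>k. on_pts (aut_pow \<aa> \<sigma> k)"
abbreviation "rel_span \<equiv> \<lambda>d p. additive_span (tensor_rels \<aa> \<sigma> d p)"
abbreviation "symbol_span \<equiv> \<lambda>d p. additive_span ((\<lambda>s. Poly_Mapping.single s (1::int)) ` symbols \<aa> \<sigma> d p)"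

lemmas iter_closed = on_pts_closed[OF scheme_end_pow]

text \<open>A slot with index k - i of the second factor lives at iterate k - i of the i-th iterate
  of p, that is, at iterate k of p, where slot k of the concatenation has to live.\<close>

lemma symbols_append:
  assumes p: "p \<in> proj_pts \<aa>" and "(r, ms) \<in> symbols \<aa> \<sigma> i p" "(r', ms') \<in> symbols \<aa> \<sigma> j (iter i p)"
  shows "(gmult \<aa> 0 p r (stalk_map \<aa> (aut_pow \<aa> \<sigma> i) p r'), ms @ ms') \<in> symbols \<aa> \<sigma> (i + j) p"
proof -
  have "(ms @ ms') ! k \<in> stalk \<aa> 1 (iter k p)" if "k < i + j" for k
  proof (cases "k < i")
    case False
    then have "ms' ! (k - i) \<in> stalk \<aa> 1 (iter (k - i) (iter i p))"
      using assms(3) that by (simp add: symbols_iff)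
    then show ?thesis
      using False assms(2) by (simp add: on_pts_aut_pow_add nth_append symbols_iff)
  qed (use assms(2) in \<open>simp add: symbols_iff nth_append\<close>)
  then show ?thesis
    using assms gmult_closed[OF p] stalk_map_closed[OF scheme_end_pow p] by (simp add: symbols_iff)
qed

lemma symbol_span_base: "s \<in> symbols \<aa> \<sigma> d p \<Longrightarrow> Poly_Mapping.single s 1 \<in> symbol_span d p"
  by (intro additive_span.base imageI)

lemma symbols_coeff:
  "(r, ms) \<in> symbols \<aa> \<sigma> d p \<Longrightarrow> r' \<in> stalk \<aa> 0 p \<Longrightarrow> (r', ms) \<in> symbols \<aa> \<sigma> d p"
  by (simp add: symbols_iff)

lemma symbols_update:
  "(r, ms) \<in> symbols \<aa> \<sigma> d p \<Longrightarrow> x \<in> stalk \<aa> 1 (iter k p) \<Longrightarrow> (r, ms[k := x]) \<in> symbols \<aa> \<sigma> d p"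
  by (cases "k < d") (auto simp: symbols_iff nth_list_update)

text \<open>A chosen representative differs from a known one by an element of
  \<open>rel_span\<close>. This inclusion ensures that it is still a combination of genuine
  symbols.\<close>

lemma rel_span_subset:
  assumes p: "p \<in> proj_pts \<aa>"
  shows "rel_span d p \<subseteq> symbol_span d p"
proof (rule additive_span_subset, rule subsetI)
  fix t assume "t \<in> tensor_rels \<aa> \<sigma> d p"
  then show "t \<in> symbol_span d p"
  proof (cases rule: tensor_rels_cases)
    case (add_coeff r r' ms)
    then show ?thesis
      using gadd_closed[OF p, of r 0 r'] symbols_coeff[of r ms d p "gadd \<aa> 0 p r r'"]
      by (auto intro!: additive_span.diff symbol_span_base simp: symbols_iff)
  next
    case (add_slot r ms k x y)
    \<comment> \<open>Only the updated lists are known to form symbols, not \<open>ms\<close>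
      itself, so the sum is inserted by a second update at the same position.\<close>
    have "ms[k := x, k := gadd \<aa> 1 (iter k p) x y] = ms[k := gadd \<aa> 1 (iter k p) x y]" by simp
    moreover have "x \<in> stalk \<aa> 1 (iter k p)" "y \<in> stalk \<aa> 1 (iter k p)"
      using add_slot by (auto simp: symbols_iff)
    ultimately have "(r, ms[k := gadd \<aa> 1 (iter k p) x y]) \<in> symbols \<aa> \<sigma> d p"
      using symbols_update[OF add_slot(2), of "gadd \<aa> 1 (iter k p) x y" k] gadd_closed[OF iter_closed[OF p]]
      by simp
    then show ?thesis
      using add_slot by (auto intro!: additive_span.diff symbol_span_base)
  next
    case (scale r ms k a)
    then have "gmult \<aa> 1 (iter k p) a (ms ! k) \<in> stalk \<aa> 1 (iter k p)"
      "gmult \<aa> 0 p r (stalk_map \<aa> (aut_pow \<aa> \<sigma> k) p a) \<in> stalk \<aa> 0 p"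
      using gmult_closed[OF p] gmult_closed[OF iter_closed[OF p]] stalk_map_closed[OF scheme_end_pow p]
      by (auto simp: symbols_iff)
    then show ?thesis
      using scale symbols_update[OF scale(2)] symbols_coeff[OF scale(2)]
      by (auto intro!: additive_span.diff symbol_span_base)
  qed
qed

lemma tmult_symbol_span:
  assumes "p \<in> proj_pts \<aa>" "t \<in> symbol_span i p" "t' \<in> symbol_span j (iter i p)"
  shows "tmult \<aa> \<sigma> i p t t' \<in> symbol_span (i + j) p"
  using _ assms(2,3)
  by (rule tmult_span) (auto simp: tmult_single intro!: symbol_span_base symbols_append assms(1))

text \<open>Multiplying a relation on the right by a symbol gives a relation of the same kind for
  the longer list. The pulled-back coefficient enters as a further factor, and commutativity of the
  local ring moves it past sums and scalars.\<close>

lemma tmult_rel_left: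
  assumes p: "p \<in> proj_pts \<aa>" and "t \<in> rel_span i p" "t' \<in> symbol_span j (iter i p)"
  shows "tmult \<aa> \<sigma> i p t t' \<in> rel_span (i + j) p"
  using _ assms(2,3)
proof (rule tmult_span)
  fix x y assume x: "x \<in> tensor_rels \<aa> \<sigma> i p" and "y \<in> (\<lambda>s. Poly_Mapping.single s (1::int)) ` symbols \<aa> \<sigma> j (iter i p)"
  then obtain r' ms' where y: "y = Poly_Mapping.single (r', ms') 1" and s': "(r', ms') \<in> symbols \<aa> \<sigma> j (iter i p)"
    by auto
  let ?\<rho> = "stalk_map \<aa> (aut_pow \<aa> \<sigma> i) p r'"
  have \<rho>: "?\<rho> \<in> stalk \<aa> 0 p"
    using s' stalk_map_closed[OF scheme_end_pow p] by (simp add: symbols_iff)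
  note app = symbols_append[OF p _ s']
  show "tmult \<aa> \<sigma> i p x y \<in> rel_span (i + j) p" using x
  proof (cases rule: tensor_rels_cases)
    case (add_coeff r1 r2 ms)
    have r: "r1 \<in> stalk \<aa> 0 p" "r2 \<in> stalk \<aa> 0 p" using add_coeff by (simp_all add: symbols_iff)
    have "gmult \<aa> 0 p (gadd \<aa> 0 p r1 r2) ?\<rho> = gadd \<aa> 0 p (gmult \<aa> 0 p r1 ?\<rho>) (gmult \<aa> 0 p r2 ?\<rho>)"
      using r \<rho> gmult_gadd[OF p] gmult_comm[OF p] gadd_closed[OF p] by metis
    then show ?thesis
      using rel_add_coeff[OF app[OF add_coeff(1)] app[OF add_coeff(2)]]
      by (auto simp: add_coeff(3) y tmult_diff_left tmult_single intro: additive_span.base)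
  next
    case (add_slot r ms k a b)
    have "length ms = i" using add_slot by (simp add: symbols_iff)
    then show ?thesis
      using rel_add_slot[of k "i + j" _ "ms @ ms'" a \<aa> \<sigma> p b] app[OF add_slot(2)] app[OF add_slot(3)] add_slot(1)
      by (auto simp: add_slot(4) y tmult_diff_left tmult_single list_update_append1 intro: additive_span.base)
  next
    case (scale r ms k a)
    let ?a = "stalk_map \<aa> (aut_pow \<aa> \<sigma> k) p a"
    have r: "r \<in> stalk \<aa> 0 p" "?a \<in> stalk \<aa> 0 p" and l: "length ms = i"
      using scale stalk_map_closed[OF scheme_end_pow p] by (simp_all add: symbols_iff)
    have "gmult \<aa> 0 p (gmult \<aa> 0 p r ?a) ?\<rho> = gmult \<aa> 0 p (gmult \<aa> 0 p r ?\<rho>) ?a"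
      using r \<rho> gmult_assoc[OF p] gmult_comm[OF p] by metis
    then show ?thesis
      using rel_scale[of k "i + j" _ "ms @ ms'" \<aa> \<sigma> p a] app[OF scale(2)] scale(1,3) l
      by (auto simp: scale(4) y tmult_diff_left tmult_single list_update_append1 nth_append intro: additive_span.base)
  qed
qed

text \<open>The relation lives at the i-th iterate of p: its slots shift by i and its coefficients
  are pulled back along \<sigma> to the power i. Additivity of the stalk map handles sums of
  coefficients; multiplicativity together with \<open>stalk_map_comp\<close> handles
  scaling.\<close>

lemma tmult_rel_right:
  assumes p: "p \<in> proj_pts \<aa>" and "t \<in> symbol_span i p" "t' \<in> rel_span j (iter i p)"
  shows "tmult \<aa> \<sigma> i p t t' \<in> rel_span (i + j) p"
  using _ assms(2,3)
proof (rule tmult_span)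
  fix x y assume y: "y \<in> tensor_rels \<aa> \<sigma> j (iter i p)" and "x \<in> (\<lambda>s. Poly_Mapping.single s (1::int)) ` symbols \<aa> \<sigma> i p"
  then obtain r ms where x: "x = Poly_Mapping.single (r, ms) 1" and s: "(r, ms) \<in> symbols \<aa> \<sigma> i p"
    by auto
  have r: "r \<in> stalk \<aa> 0 p" and l: "length ms = i" using s by (simp_all add: symbols_iff)
  note q = iter_closed[OF p, of i]
  note app = symbols_append[OF p s]
  note closed = stalk_map_closed[OF scheme_end_pow p]
  show "tmult \<aa> \<sigma> i p x y \<in> rel_span (i + j) p" using y
  proof (cases rule: tensor_rels_cases)
    case (add_coeff r1 r2 ms')
    have r12: "r1 \<in> stalk \<aa> 0 (iter i p)" "r2 \<in> stalk \<aa> 0 (iter i p)" using add_coeff by (simp_all add: symbols_iff)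
    then show ?thesis
      using rel_add_coeff[OF app[OF add_coeff(1)] app[OF add_coeff(2)]]
      by (auto simp: add_coeff(3) x tmult_diff_right tmult_single stalk_map_gadd[OF scheme_end_pow p r12]
          gmult_gadd[OF p r closed closed] intro: additive_span.base)
  next
    case (add_slot r' ms' k a b)
    have u: "ms @ ms'[k := c] = (ms @ ms')[i + k := c]" for c
      using l by (simp add: list_update_append)
    show ?thesis
      using rel_add_slot[of "i + k" "i + j" _ "ms @ ms'" a \<aa> \<sigma> p b] app[OF add_slot(2)] app[OF add_slot(3)] add_slot(1)
      by (auto simp: add_slot(4) x tmult_diff_right tmult_single u on_pts_aut_pow_add intro: additive_span.base)
  next
    case (scale r' ms' k a)
    let ?b = "stalk_map \<aa> (aut_pow \<aa> \<sigma> k) (iter i p) a"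
    have r': "r' \<in> stalk \<aa> 0 (iter i p)" and b: "?b \<in> stalk \<aa> 0 (iter i p)"
      using scale stalk_map_closed[OF scheme_end_pow q] by (simp_all add: symbols_iff)
    have a: "a \<in> stalk \<aa> 0 (iter (i + k) p)" using scale(3) by (simp add: on_pts_aut_pow_add)
    have u: "ms @ ms'[k := c] = (ms @ ms')[i + k := c]" for c
      using l by (simp add: list_update_append)
    show ?thesis
      using rel_scale[of "i + k" "i + j" _ "ms @ ms'" \<aa> \<sigma> p a] app[OF scale(2)] scale(1) a l
      by (auto simp: scale(4) x tmult_diff_right tmult_single u nth_append on_pts_aut_pow_add
          stalk_map_gmult[OF scheme_end_pow p r' b] stalk_map_comp[OF p a]
          gmult_assoc[OF p r closed[OF r'] closed[OF a], symmetric] intro: additive_span.base)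
  qed
qed

end

section \<open>Products of three generators\<close>

context proj_scheme_aut
begin

text \<open>A homogeneous element given by explicit representatives at the points. For such elements
  the choices in the product of B are resolved once and for all.\<close>

definition concentrated :: "nat \<Rightarrow> (('v, 'k) pt \<Rightarrow> (('v, 'k) symb \<Rightarrow>\<^sub>0 int)) \<Rightarrow> nat \<Rightarrow> ('v, 'k) pt \<Rightarrow> ('v, 'k) tensor" where
  "concentrated m t = (\<lambda>d. restrict (\<lambda>p. tclass \<aa> \<sigma> d p (if d = m then t p else 0)) (proj_pts \<aa>))"

lemma some_concentrated:
  assumes p: "p \<in> proj_pts \<aa>" and t: "t p \<in> symbol_span m p"
  defines "u \<equiv> \<lambda>d. SOME x. x \<in> concentrated m t d p"
  shows "u d - (if d = m then t p else 0) \<in> rel_span d p" "u d \<in> symbol_span d p"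
proof -
  show *: "u d - (if d = m then t p else 0) \<in> rel_span d p"
    using p some_in_tclass[of \<aa> \<sigma> d p "if d = m then t p else 0"] by (simp add: u_def concentrated_def)
  have "(if d = m then t p else 0) \<in> symbol_span d p"
    using t by (auto intro: additive_span.zero)
  from additive_span_add[OF subsetD[OF rel_span_subset[OF p] *] this] show "u d \<in> symbol_span d p"
    by simp
qed

lemma mult_concentrated:
  assumes t: "\<And>p. p \<in> proj_pts \<aa> \<Longrightarrow> t p \<in> symbol_span m p"
    and t': "\<And>p. p \<in> proj_pts \<aa> \<Longrightarrow> t' p \<in> symbol_span n p"
  shows "concentrated m t \<otimes>\<^bsub>twisted_coordinate_ring \<aa> \<sigma>\<^esub> concentrated n t'
    = concentrated (m + n) (\<lambda>p. tmult \<aa> \<sigma> m p (t p) (t' (iter m p)))"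
proof
  fix l
  have "tclass \<aa> \<sigma> l p (\<Sum>i\<le>l. tmult \<aa> \<sigma> i p (SOME x. x \<in> concentrated m t i p)
          (SOME x. x \<in> concentrated n t' (l - i) (iter i p)))
      = tclass \<aa> \<sigma> l p (if l = m + n then tmult \<aa> \<sigma> m p (t p) (t' (iter m p)) else 0)"
    if p: "p \<in> proj_pts \<aa>" for p
  proof -
    define u where "u i = (SOME x. x \<in> concentrated m t i p)" for i
    define v where "v i = (SOME x. x \<in> concentrated n t' (l - i) (iter i p))" for i
    define a where "a i = (if i = m then t p else 0)" for i
    define b where "b i = (if l - i = n then t' (iter i p) else 0)" for i
    have u: "u i - a i \<in> rel_span i p" "u i \<in> symbol_span i p" for i
      unfolding u_def a_def by (rule some_concentrated; use p t in simp)+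
    have v: "v i - b i \<in> rel_span (l - i) (iter i p)" "v i \<in> symbol_span (l - i) (iter i p)" for i
      unfolding v_def b_def by (rule some_concentrated; use iter_closed[OF p] t' in simp)+
    have b: "a i \<in> symbol_span i p" for i
      unfolding a_def using t[OF p] by (auto intro: additive_span.zero)
    have "tmult \<aa> \<sigma> i p (u i) (v i) - tmult \<aa> \<sigma> i p (a i) (b i) \<in> rel_span l p" if "i \<le> l" for i
    proof -
      \<comment> \<open>One factor is exchanged at a time: the first term needs the chosen
        \<open>v i\<close>, the second the known \<open>a i\<close>, to be a combination of
        symbols.\<close>
      have "tmult \<aa> \<sigma> i p (u i) (v i) - tmult \<aa> \<sigma> i p (a i) (b i)
          = tmult \<aa> \<sigma> i p (u i - a i) (v i) + tmult \<aa> \<sigma> i p (a i) (v i - b i)"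
        by (simp add: tmult_diff_left tmult_diff_right)
      also have "\<dots> \<in> rel_span (i + (l - i)) p"
        by (intro additive_span_add tmult_rel_left tmult_rel_right p u v b)
      finally show ?thesis using that by simp
    qed
    then have *: "(\<Sum>i\<le>l. tmult \<aa> \<sigma> i p (u i) (v i)) - (\<Sum>i\<le>l. tmult \<aa> \<sigma> i p (a i) (b i)) \<in> rel_span l p"
      unfolding sum_subtractf[symmetric] by (intro additive_span_sum) auto
    have "(\<Sum>i\<le>l. tmult \<aa> \<sigma> i p (a i) (b i))
        = (\<Sum>i\<le>l. if i = m then tmult \<aa> \<sigma> m p (t p) (b m) else 0)"
      by (intro sum.cong) (auto simp: a_def)
    \<comment> \<open>Truncated subtraction is harmless: the index m occurs only if m \<le> l, and
      then l - m = n is equivalent to l = m + n.\<close>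
    also have "\<dots> = (if l = m + n then tmult \<aa> \<sigma> m p (t p) (t' (iter m p)) else 0)"
      by (auto simp: b_def)
    finally show ?thesis
      using * by (simp add: tclass_eq_iff u_def v_def)
  qed
  then show "(concentrated m t \<otimes>\<^bsub>twisted_coordinate_ring \<aa> \<sigma>\<^esub> concentrated n t') l
      = concentrated (m + n) (\<lambda>p. tmult \<aa> \<sigma> m p (t p) (t' (iter m p))) l"
    unfolding twisted_coordinate_ring_def concentrated_def[of "m + n"] by (simp cong: restrict_cong)
qed

section \<open>Coordinates as local generators\<close>

definition coord :: "'v \<Rightarrow> ('v, 'k) pt \<Rightarrow> ('v, 'k) germ" where
  "coord v p = frac \<aa> p 1 (mvar v) 1"

lemma is_frac_coord: "p \<in> proj_pts \<aa> \<Longrightarrow> is_frac p 1 (mvar v) 1"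
  unfolding is_frac_def using homog_mvar[of v] homog_one pt_one by (intro conjI exI[of _ 0]) auto

lemma coord_in_stalk: "p \<in> proj_pts \<aa> \<Longrightarrow> coord v p \<in> stalk \<aa> 1 p"
  unfolding coord_def by (intro frac_in_stalk is_frac_coord)

lemma is_frac_ratio: "mvar v \<notin> p \<Longrightarrow> is_frac p 0 (mvar i) (mvar v)"
  unfolding is_frac_def using homog_mvar[of v] homog_mvar[of i] by auto

lemma ratio_coord:
  assumes p: "p \<in> proj_pts \<aa>" and v: "mvar v \<notin> p"
  shows "gmult \<aa> 1 p (frac \<aa> p 0 (mvar i) (mvar v)) (coord v p) = coord i p"
proof -
  have "gmult \<aa> 1 p (frac \<aa> p 0 (mvar i) (mvar v)) (coord v p) = frac \<aa> p 1 (mvar i * mvar v) (mvar v * 1)"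
    unfolding coord_def by (intro gmult_frac[OF p] is_frac_ratio v is_frac_coord p)
  also have "\<dots> = coord i p"
    unfolding coord_def
    using is_frac_mult[OF p is_frac_ratio[OF v, of i] is_frac_coord[OF p, of v]] is_frac_coord[OF p, of i]
    by (intro frac_eqI'[OF p]) simp_all
  finally show ?thesis .
qed

lemma tclass_scale:
  assumes p: "p \<in> proj_pts \<aa>" and "k < d" "(r, ms) \<in> symbols \<aa> \<sigma> d p" "a \<in> stalk \<aa> 0 (iter k p)"
  shows "tclass \<aa> \<sigma> d p (Poly_Mapping.single (gmult \<aa> 0 p r (stalk_map \<aa> (aut_pow \<aa> \<sigma> k) p a), ms) 1)
    = tclass \<aa> \<sigma> d p (Poly_Mapping.single (r, ms[k := gmult \<aa> 1 (iter k p) a (ms ! k)]) 1)"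
  unfolding tclass_eq_iff using additive_span.base[OF rel_scale[OF assms(2-4)]] .

text \<open>Multiplication by y on the stalk is \<open>tmult\<close> by the degree zero symbol
  \<open>(y, [])\<close>, with the identity as stalk map, so it respects relations by
  \<open>tmult_rel_right\<close> for i = 0.\<close>

lemma tclass_coeff_mult:
  assumes p: "p \<in> proj_pts \<aa>" and y: "y \<in> stalk \<aa> 0 p" and r: "r \<in> stalk \<aa> 0 p" "r' \<in> stalk \<aa> 0 p"
    and eq: "tclass \<aa> \<sigma> d p (Poly_Mapping.single (r, ms) 1) = tclass \<aa> \<sigma> d p (Poly_Mapping.single (r', ms) 1)"
  shows "tclass \<aa> \<sigma> d p (Poly_Mapping.single (gmult \<aa> 0 p y r, ms) 1)
    = tclass \<aa> \<sigma> d p (Poly_Mapping.single (gmult \<aa> 0 p y r', ms) 1)"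
proof -
  let ?t = "Poly_Mapping.single (r, ms) 1 - Poly_Mapping.single (r', ms) (1::int)"
  have "?t \<in> rel_span d (iter 0 p)" using eq by (simp add: tclass_eq_iff)
  moreover have "Poly_Mapping.single (y, []) 1 \<in> symbol_span 0 p"
    using y by (intro symbol_span_base) (simp add: symbols_iff)
  ultimately have "tmult \<aa> \<sigma> 0 p (Poly_Mapping.single (y, []) 1) ?t \<in> rel_span (0 + d) p"
    using tmult_rel_right[OF p] by blast
  then show ?thesis
    by (simp add: tclass_eq_iff tmult_diff_right tmult_single stalk_map_id[OF p] r del: aut_pow.simps)
qed

text \<open>If \<open>x\<^sub>v\<close>, \<open>x\<^sub>u\<close>, \<open>x\<^sub>w\<close> generate \<open>\<L>\<close> at \<open>p\<close>, \<open>\<sigma> p\<close>, \<open>\<sigma>\<^sup>2 p\<close>, then \<open>x\<^sub>i x\<^sub>j x\<^sub>k = a\<^sub>i b\<^sub>j c\<^sub>k T\<close> for the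
  generator \<open>T = x\<^sub>v x\<^sub>u x\<^sub>w\<close> of the stalk of \<open>\<L>\<^sub>3\<close>, with \<open>a\<^sub>v = b\<^sub>u = c\<^sub>w = 1\<close>.  Moving \<open>z\<close> through
  \<open>x\<^sub>v x\<^sub>u z\<close> and \<open>z x\<^sub>j x\<^sub>w\<close> gives \<open>c\<^sub>z T = a\<^sub>z b\<^sub>v c\<^sub>u T\<close> and \<open>a\<^sub>z b\<^sub>j T = a\<^sub>j b\<^sub>z T\<close>, whence
  \<open>a\<^sub>i b\<^sub>j c\<^sub>z T = a\<^sub>i a\<^sub>j b\<^sub>z b\<^sub>v c\<^sub>u T\<close>, which is symmetric in \<open>i\<close> and \<open>j\<close>.  The common factor \<open>e\<close> is the
  product of units that \<open>tmult\<close> produces and need not be simplified.\<close>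

lemma central_coord_commutes:
  fixes z :: 'v
  assumes p: "p \<in> proj_pts \<aa>" and e: "e \<in> stalk \<aa> 0 p"
  defines "word \<equiv> \<lambda>i j k. tclass \<aa> \<sigma> 3 p (Poly_Mapping.single (e, [coord i p, coord j (iter 1 p), coord k (iter 2 p)]) 1)"
  assumes rot: "\<And>i j. word i j z = word z i j"
    and swap: "\<And>i j. word z i j = word i z j"
  shows "word i j z = word j i z"
proof -
  let ?M = "\<lparr>carrier = stalk \<aa> 0 p, monoid.mult = gmult \<aa> 0 p, one = frac \<aa> p 0 1 1\<rparr>"
  interpret M: comm_monoid ?M by (rule stalk_comm_monoid[OF p])
  define q where "q k = iter k p" for k
  have q: "q k \<in> proj_pts \<aa>" for k unfolding q_def by (rule iter_closed[OF p])
  have "\<forall>k. \<exists>v. mvar v \<notin> q k" using pt_mvar[OF q] by metis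
  then obtain v where v: "\<And>k. mvar (v k) \<notin> q k" by metis
  define T where "T r = tclass \<aa> \<sigma> 3 p
    (Poly_Mapping.single (r, [coord (v 0) (q 0), coord (v 1) (q 1), coord (v 2) (q 2)]) 1)" for r
  \<comment> \<open>The ratio of coordinate i to the nonvanishing coordinate \<open>v k\<close> at
    the k-th iterate, pulled back to p so that all coefficients lie in one local ring.\<close>
  define c where "c k i = stalk_map \<aa> (aut_pow \<aa> \<sigma> k) p (frac \<aa> (q k) 0 (mvar i) (mvar (v k)))" for k i
  have ratio: "frac \<aa> (q k) 0 (mvar i) (mvar (v k)) \<in> stalk \<aa> 0 (iter k p)" for k i
    unfolding q_def[symmetric] by (intro frac_in_stalk is_frac_ratio v)
  have c: "c k i \<in> stalk \<aa> 0 p" for k i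
    unfolding c_def by (intro stalk_map_closed scheme_end_pow p ratio)
  have sym: "(r, [coord x (q 0), coord y (q 1), coord w (q 2)]) \<in> symbols \<aa> \<sigma> 3 p" if "r \<in> stalk \<aa> 0 p" for r x y w
    using that coord_in_stalk[OF q] unfolding symbols_iff q_def[symmetric]
    by (auto simp: numeral_3_eq_3 less_Suc_eq numeral_2_eq_2)
  have scale: "tclass \<aa> \<sigma> 3 p (Poly_Mapping.single (gmult \<aa> 0 p r (c k i), ms) 1)
      = tclass \<aa> \<sigma> 3 p (Poly_Mapping.single (r, ms[k := coord i (q k)]) 1)"
    if "(r, ms) \<in> symbols \<aa> \<sigma> 3 p" "k < 3" "ms ! k = coord (v k) (q k)" for r ms k i
    using tclass_scale[OF p that(2,1) ratio, of i] that(3) ratio_coord[OF q v, of k i]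
    by (simp add: c_def q_def)
  have M: "gmult \<aa> 0 p r s \<in> stalk \<aa> 0 p" if "r \<in> stalk \<aa> 0 p" "s \<in> stalk \<aa> 0 p" for r s
    by (rule gmult_closed[OF p that])
  have word: "word i j k = T (gmult \<aa> 0 p (gmult \<aa> 0 p (gmult \<aa> 0 p e (c 0 i)) (c 1 j)) (c 2 k))" for i j k
  proof -
    have "T (gmult \<aa> 0 p (gmult \<aa> 0 p (gmult \<aa> 0 p e (c 0 i)) (c 1 j)) (c 2 k))
       = tclass \<aa> \<sigma> 3 p (Poly_Mapping.single (gmult \<aa> 0 p (gmult \<aa> 0 p e (c 0 i)) (c 1 j),
           [coord (v 0) (q 0), coord (v 1) (q 1), coord k (q 2)]) 1)"
      unfolding T_def by (subst scale) (simp_all add: sym[unfolded One_nat_def] M e c)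
    also have "\<dots> = tclass \<aa> \<sigma> 3 p (Poly_Mapping.single (gmult \<aa> 0 p e (c 0 i),
           [coord (v 0) (q 0), coord j (q 1), coord k (q 2)]) 1)"
      by (subst scale) (simp_all add: sym[unfolded One_nat_def] M e c)
    also have "\<dots> = tclass \<aa> \<sigma> 3 p (Poly_Mapping.single (e, [coord i (q 0), coord j (q 1), coord k (q 2)]) 1)"
      by (subst scale) (simp_all add: sym[unfolded One_nat_def] M e c)
    also have "\<dots> = word i j k"
      by (simp add: word_def q_def)
    finally show ?thesis by simp
  qed
  \<comment> \<open>Moving the ratio \<open>c k (v k)\<close> into slot k replaces the generator
    there by itself, so such factors can be inserted under \<open>T\<close> at will.\<close>
  have unit: "T (gmult \<aa> 0 p r (c k (v k))) = T r" if "r \<in> stalk \<aa> 0 p" "k < 3" for r k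
  proof -
    have k: "k = 0 \<or> k = 1 \<or> k = 2" using that(2) by auto
    have "[coord (v 0) (q 0), coord (v 1) (q 1), coord (v 2) (q 2)] ! k = coord (v k) (q k)"
      using k by auto
    then show ?thesis
      unfolding T_def using scale[OF sym[OF that(1)] that(2)] by (metis list_update_id)
  qed
  have mult: "T (gmult \<aa> 0 p y r) = T (gmult \<aa> 0 p y r')"
    if "y \<in> stalk \<aa> 0 p" "r \<in> stalk \<aa> 0 p" "r' \<in> stalk \<aa> 0 p" "T r = T r'" for y r r'
    using tclass_coeff_mult[OF p that(1-3)] that(4) by (simp add: T_def)
  note m_ac = M.m_ac[simplified]
  have main: "word i j z = T (gmult \<aa> 0 p (gmult \<aa> 0 p (gmult \<aa> 0 p (c 0 i) (c 1 (v 0))) (c 2 (v 1)))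
      (gmult \<aa> 0 p (gmult \<aa> 0 p (gmult \<aa> 0 p e (c 0 j)) (c 1 z)) (c 2 (v 2))))" for i j
  proof -
    \<comment> \<open>The two inserted units complete \<open>e\<close> and \<open>c 2 z\<close> to
      the coefficient of \<open>word (v 0) (v 1) z\<close>, the shape to which \<open>rot\<close>
      applies.\<close>
    have "word i j z = T (gmult \<aa> 0 p (gmult \<aa> 0 p (gmult \<aa> 0 p (gmult \<aa> 0 p (gmult \<aa> 0 p e (c 0 i)) (c 1 j)) (c 2 z))
        (c 0 (v 0))) (c 1 (v 1)))"
      unfolding word by (simp add: unit[of _ 0] unit[of _ 1, unfolded One_nat_def] M e c)
    also have "\<dots> = T (gmult \<aa> 0 p (gmult \<aa> 0 p (c 0 i) (c 1 j))
        (gmult \<aa> 0 p (gmult \<aa> 0 p (gmult \<aa> 0 p e (c 0 (v 0))) (c 1 (v 1))) (c 2 z)))"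
      by (simp add: m_ac M e c)
    also have "\<dots> = T (gmult \<aa> 0 p (gmult \<aa> 0 p (c 0 i) (c 1 j))
        (gmult \<aa> 0 p (gmult \<aa> 0 p (gmult \<aa> 0 p e (c 0 z)) (c 1 (v 0))) (c 2 (v 1))))"
      using rot[of "v 0" "v 1"] unfolding word by (intro mult M e c)
    \<comment> \<open>A third unit \<open>c 2 (v 2)\<close> is inserted in order to isolate the
      coefficient of \<open>word z j (v 2)\<close> for \<open>swap\<close>.\<close>
    also have "\<dots> = T (gmult \<aa> 0 p (gmult \<aa> 0 p (gmult \<aa> 0 p (c 0 i) (c 1 j))
        (gmult \<aa> 0 p (gmult \<aa> 0 p (gmult \<aa> 0 p e (c 0 z)) (c 1 (v 0))) (c 2 (v 1)))) (c 2 (v 2)))"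
      by (subst unit) (auto intro!: M e c)
    also have "\<dots> = T (gmult \<aa> 0 p (gmult \<aa> 0 p (gmult \<aa> 0 p (c 0 i) (c 1 (v 0))) (c 2 (v 1)))
        (gmult \<aa> 0 p (gmult \<aa> 0 p (gmult \<aa> 0 p e (c 0 z)) (c 1 j)) (c 2 (v 2))))"
      by (simp add: m_ac M e c)
    also have "\<dots> = T (gmult \<aa> 0 p (gmult \<aa> 0 p (gmult \<aa> 0 p (c 0 i) (c 1 (v 0))) (c 2 (v 1)))
        (gmult \<aa> 0 p (gmult \<aa> 0 p (gmult \<aa> 0 p e (c 0 j)) (c 1 z)) (c 2 (v 2))))"
      using swap[of j "v 2"] unfolding word by (intro mult M e c)
    finally show ?thesis .
  qed
  have "word i j z = T (gmult \<aa> 0 p (gmult \<aa> 0 p (gmult \<aa> 0 p (c 0 j) (c 1 (v 0))) (c 2 (v 1)))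
      (gmult \<aa> 0 p (gmult \<aa> 0 p (gmult \<aa> 0 p e (c 0 i)) (c 1 z)) (c 2 (v 2))))"
    unfolding main by (simp add: m_ac M e c)
  then show ?thesis unfolding main[of j i] .
qed

end

section \<open>Modules over presented algebras\<close>

lemma ring_of_type_algebra_ring: "ring (ring_of_type_algebra :: 'a::ring_1 ring)"
proof -
  have "\<exists>y. y + x = 0" for x :: 'a by (rule exI[of _ "- x"]) simp
  then show ?thesis
    by unfold_locales (auto simp: Units_def algebra_simps add_eq_0_iff2)
qed

lemma ideal_relideal: "ideal (relideal F) free_algebra"
  unfolding relideal_def by (rule ring.genideal_ideal[OF ring_of_type_algebra_ring]) simp

lemma ring_presented: "ring (presented F)"
  unfolding presented_def by (rule ideal.quotient_is_ring[OF ideal_relideal])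

lemma toalg_hom: "toalg F \<in> ring_hom free_algebra (presented F)"
  unfolding presented_def toalg_def[abs_def] by (rule ideal.rcos_ring_hom[OF ideal_relideal])

lemma toalg_closed [simp]: "toalg F f \<in> carrier (presented F)"
  using ring_hom_closed[OF toalg_hom] by simp

lemma toalg_add: "toalg F (f + g) = toalg F f \<oplus>\<^bsub>presented F\<^esub> toalg F g"
  using ring_hom_add[OF toalg_hom] by simp

lemma toalg_mult: "toalg F (f * g) = toalg F f \<otimes>\<^bsub>presented F\<^esub> toalg F g"
  using ring_hom_mult[OF toalg_hom] by simp

lemma toalg_one: "toalg F 1 = \<one>\<^bsub>presented F\<^esub>"
  using ring_hom_one[OF toalg_hom] by simp

lemma toalg_zero: "toalg F 0 = \<zero>\<^bsub>presented F\<^esub>"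
  using ring_hom_zero[OF toalg_hom ring_of_type_algebra_ring ring_presented] by simp

lemma carrier_presented: "carrier (presented F) = range (toalg F)"
  by (auto simp: presented_def FactRing_def A_RCOSETS_def' toalg_def a_r_coset_def')

lemma toalg_eqI:
  assumes "f - g \<in> F"
  shows "toalg F f = toalg F g"
proof -
  interpret ideal "relideal F" free_algebra by (rule ideal_relideal)
  have "f - g \<in> relideal F"
    unfolding relideal_def
    using ring.genideal_self[OF ring_of_type_algebra_ring, of F] assms by auto
  then have "f \<in> relideal F +>\<^bsub>free_algebra\<^esub> g"
    unfolding a_r_coset_def' by (intro UN_I[of "f - g"]) simp_all
  then show ?thesis
    unfolding toalg_def using a_repr_independence' by simp
qed

lemma single_eq_monomial: "Poly_Mapping.single w c = ncconst c * (\<Prod>v\<leftarrow>w. ncvar v)"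
proof (induction w arbitrary: c)
  case Nil
  then show ?case by (simp add: ncconst_def)
next
  case (Cons v w)
  have "Poly_Mapping.single (v # w) c = ncconst c * (ncvar v * Poly_Mapping.single w 1)"
    by (simp add: ncconst_def ncvar_def mult_single plus_list_def)
  then show ?case using Cons[of 1] by (simp add: ncconst_def flip: zero_list_def)
qed

lemma ncpoly_induct [case_names const var add mult]:
  assumes const: "\<And>c. P (ncconst c)" and var: "\<And>v. P (ncvar v)"
    and add: "\<And>f g. P f \<Longrightarrow> P g \<Longrightarrow> P (f + g)" and mult: "\<And>f g. P f \<Longrightarrow> P g \<Longrightarrow> P (f * g)"
  shows "P (f :: ('v, 'k::field) ncpoly)"
proof -
  have zero: "P 0" using const[of 0] by (simp add: ncconst_def)
  have one: "P 1" using const[of 1] by (simp add: ncconst_def flip: zero_list_def)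
  have "P (\<Prod>v\<leftarrow>w. ncvar v)" for w
    by (induction w) (auto intro: one mult var)
  then have single: "P (Poly_Mapping.single w c)" for w c
    unfolding single_eq_monomial by (intro mult const)
  have "f = (\<Sum>w\<in>Poly_Mapping.keys f. Poly_Mapping.single w (Poly_Mapping.lookup f w))"
    by (rule poly_mapping_eqI)
      (simp add: lookup_sum lookup_single when_def sum.delta in_keys_iff)
  moreover have "P (\<Sum>w\<in>A. Poly_Mapping.single w (Poly_Mapping.lookup f w))" for A
    by (induction A rule: infinite_finite_induct) (auto intro: zero single add)
  ultimately show ?thesis by metis
qed

lemma ncconst_mult: "ncconst c * f = f * ncconst c" for f :: "('v, 'k::field) ncpoly"
proof (induction f rule: ncpoly_induct)
  case (mult f g)
  then show ?case by (metis mult.assoc)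
qed (simp_all add: ncconst_def ncvar_def mult_single plus_list_def mult.commute algebra_simps)

text \<open>Take a nonzero polynomial p of least degree with p(T) x = 0 and a root c of p. Writing p
  = (X - c) q, the vector q(T) x is nonzero by minimality and is killed by T - c. The assumption on
  roots expresses algebraic closedness, as the scalars of the locale form an arbitrary
  field.\<close>

lemma (in vector_space) eigenvector_exists:
  fixes T :: "'b \<Rightarrow> 'b" and x :: 'b
  assumes add: "\<And>x y. T (x + y) = T x + T y" and sc: "\<And>c x. T (scale c x) = scale c (T x)"
    and B: "finite B" "span B = UNIV" and x: "x \<noteq> 0"
    and root: "\<And>p :: 'a poly. degree p > 0 \<Longrightarrow> \<exists>c. poly p c = 0"
  obtains c y where "y \<noteq> 0" "T y = scale c y"
proof -
  have T_sum: "T (sum g A) = (\<Sum>i\<in>A. T (g i))" for g :: "nat \<Rightarrow> 'b" and A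
    using add[of 0 0] by (induction A rule: infinite_finite_induct) (auto simp: add)
  define ev where "ev p = (\<Sum>i\<le>degree p. scale (coeff p i) ((T ^^ i) x))" for p
  have ev_alt: "ev p = (\<Sum>i\<le>n. scale (coeff p i) ((T ^^ i) x))" if "degree p \<le> n" for p n
    unfolding ev_def using that
    by (intro sum.mono_neutral_left) (auto simp: coeff_eq_0)
  have ev_add: "ev (p + q) = ev p + ev q" for p q
    using degree_add_le_max[of p q]
    by (simp add: ev_alt[of _ "max (degree p) (degree q)"] scale_left_distrib sum.distrib)
  have ev_smult: "ev (smult c p) = scale c (ev p)" for c p
    using degree_smult_le[of c p]
    by (simp add: ev_alt[of _ "degree p"] scale_sum_right)
  have ev_pCons: "ev (pCons a p) = scale a x + T (ev p)" for a p
  proof -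
    have "ev (pCons a p) = (\<Sum>i\<le>Suc (degree p). scale (coeff (pCons a p) i) ((T ^^ i) x))"
      by (rule ev_alt) (rule degree_pCons_le)
    also have "\<dots> = scale a x + (\<Sum>i\<le>degree p. scale (coeff p i) ((T ^^ Suc i) x))"
      by (subst sum.atMost_Suc_shift) simp
    also have "(\<Sum>i\<le>degree p. scale (coeff p i) ((T ^^ Suc i) x)) = T (ev p)"
      unfolding ev_def T_sum by (simp add: sc)
    finally show ?thesis .
  qed
  have ev_monom: "ev (monom c i) = scale c ((T ^^ i) x)" for c i
  proof -
    have "ev (monom c i) = (\<Sum>j\<le>i. scale (coeff (monom c i) j) ((T ^^ j) x))"
      by (rule ev_alt) (rule degree_monom_le)
    also have "\<dots> = (\<Sum>j\<le>i. if j = i then scale c ((T ^^ j) x) else 0)"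
      by (intro sum.cong) auto
    finally show ?thesis by simp
  qed
  \<comment> \<open>The iterates with exponents 0 to \<open>card B\<close> are one more than the
    dimension allows. If two of them coincide, the set of iterates is smaller than that count, and a
    difference of two monomials serves instead.\<close>
  have "\<exists>p. p \<noteq> 0 \<and> ev p = 0"
  proof (cases "inj_on (\<lambda>i. (T ^^ i) x) {..card B}")
    case False
    then obtain i j where ij: "i \<noteq> j" "(T ^^ i) x = (T ^^ j) x" by (auto simp: inj_on_def)
    have "coeff (monom 1 i + smult (- 1) (monom 1 j)) i = (1 :: 'a)" using ij by simp
    then have "monom 1 i + smult (- 1) (monom 1 j) \<noteq> (0 :: 'a poly)" by (metis coeff_0 zero_neq_one)
    then show ?thesis
      using ij by (intro exI[of _ "monom 1 i + smult (- 1) (monom 1 j)"]) (simp only: ev_add ev_smult ev_monom, simp)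
  next
    case True
    let ?S = "(\<lambda>i. (T ^^ i) x) ` {..card B}"
    have "card ?S = Suc (card B)" using card_image[OF True] by simp
    then have "dependent ?S"
      using independent_span_bound[OF B(1), of ?S] B(2) by auto
    then obtain u w where u: "(\<Sum>v\<in>?S. scale (u v) v) = 0" "w \<in> ?S" "u w \<noteq> 0"
      using dependent_finite[of ?S] by auto
    define p where "p = (\<Sum>i\<le>card B. monom (u ((T ^^ i) x)) i)"
    have "ev (sum (\<lambda>i. monom (c i) i) A) = (\<Sum>i\<in>A. scale (c i) ((T ^^ i) x))" if "finite A" for c A
      using that by induction (auto simp: ev_add ev_monom, simp add: ev_def)
    then have "ev p = (\<Sum>i\<le>card B. scale (u ((T ^^ i) x)) ((T ^^ i) x))" by (simp add: p_def)
    also have "\<dots> = 0" using u(1) by (subst (asm) sum.reindex[OF True]) simp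
    finally have "ev p = 0" .
    moreover obtain i where "i \<le> card B" "w = (T ^^ i) x" using u(2) by auto
    then have "coeff p i \<noteq> 0" using u(3) by (simp add: p_def coeff_sum)
    then have "p \<noteq> 0" by auto
    ultimately show ?thesis by blast
  qed
  then obtain p where p: "p \<noteq> 0" "ev p = 0" and min: "\<And>q. q \<noteq> 0 \<Longrightarrow> ev q = 0 \<Longrightarrow> degree p \<le> degree q"
    using ex_has_least_nat[of "\<lambda>p. p \<noteq> 0 \<and> ev p = 0" _ degree] by blast
  have "degree p \<noteq> 0"
  proof
    assume "degree p = 0"
    then obtain a where "p = [:a:]" by (rule degree_eq_zeroE)
    then have "scale a x = 0" "a \<noteq> 0" using p by (auto simp: ev_def)
    then show False using x by (simp add: scale_eq_0_iff)
  qed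
  then obtain c where "poly p c = 0" using root[of p] by auto
  then obtain q where q: "p = [:- c, 1:] * q" by (auto simp: poly_eq_0_iff_dvd)
  then have "q \<noteq> 0" using p by auto
  then have "degree p = Suc (degree q)" unfolding q by (subst degree_mult_eq) auto
  then have "ev q \<noteq> 0" using min \<open>q \<noteq> 0\<close> by force
  moreover have "p = pCons 0 q + smult (- c) q" unfolding q by simp
  then have "T (ev q) = scale c (ev q)"
    using p(2) by (simp only: ev_add ev_smult ev_pCons) simp
  ultimately show thesis using that by blast
qed

section \<open>Modules over a presented algebra as vector spaces with operators\<close>

context
  fixes F :: "('v, 'k::field) ncpoly set" and act :: "('v, 'k) ncpoly set \<Rightarrow> 'm::ab_group_add \<Rightarrow> 'm"
  assumes module: "left_module (presented F) act"
begin

lemma act_add: "act (toalg F (f + g)) x = act (toalg F f) x + act (toalg F g) x"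
  and act_mult: "act (toalg F (f * g)) x = act (toalg F f) (act (toalg F g) x)"
  and act_one: "act (toalg F 1) x = x"
  and act_distrib: "act (toalg F f) (x + y) = act (toalg F f) x + act (toalg F f) y"
  using module by (auto simp: left_module_def toalg_add toalg_mult toalg_one)

lemma act_zero: "act (toalg F f) 0 = 0"
  using act_distrib[of f 0 0] by simp

lemma act_diff: "act (toalg F (f - g)) x = act (toalg F f) x - act (toalg F g) x"
  using act_add[of "f - g" g x] by (simp add: algebra_simps)

lemma kscale_vector_space: "vector_space (kscale F act)"
proof
  fix a b :: 'k and x y :: 'm
  show "kscale F act a (x + y) = kscale F act a x + kscale F act a y"
    by (simp add: kscale_def act_distrib)
  show "kscale F act (a + b) x = kscale F act a x + kscale F act b x"
    by (simp add: kscale_def ncconst_def single_add act_add)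
  show "kscale F act a (kscale F act b x) = kscale F act (a * b) x"
    unfolding kscale_def act_mult[symmetric] by (simp add: ncconst_def mult_single plus_list_def)
  show "kscale F act 1 x = x"
    using act_one by (simp add: kscale_def ncconst_def flip: zero_list_def)
qed

lemma act_kscale: "act (toalg F f) (kscale F act c x) = kscale F act c (act (toalg F f) x)"
  unfolding kscale_def act_mult[symmetric] ncconst_mult ..

text \<open>T is a parameter because commutation is obtained in two rounds: with T the action of a
  generator, and then with T the action of an arbitrary element.\<close>

lemma act_commute_induct:
  assumes var: "\<And>v x. T (act (toalg F (ncvar v)) x) = act (toalg F (ncvar v)) (T x)"
    and const: "\<And>c x. T (kscale F act c x) = kscale F act c (T x)"
    and add: "\<And>x y. T (x + y) = T x + T y"
  shows "T (act (toalg F f) x) = act (toalg F f) (T x)"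
proof (induction f arbitrary: x rule: ncpoly_induct)
  case (const c)
  then show ?case using assms(2) by (simp add: kscale_def)
qed (simp_all add: var add act_add act_mult)

lemma act_commute:
  assumes "\<And>u v x. act (toalg F (ncvar u)) (act (toalg F (ncvar v)) x)
    = act (toalg F (ncvar v)) (act (toalg F (ncvar u)) x)"
  shows "act (toalg F f) (act (toalg F g) x) = act (toalg F g) (act (toalg F f) x)"
proof (rule act_commute_induct)
  fix v x
  show "act (toalg F f) (act (toalg F (ncvar v)) x) = act (toalg F (ncvar v)) (act (toalg F f) x)"
    by (rule act_commute_induct[symmetric]) (simp_all add: act_kscale act_distrib assms)
qed (simp_all add: act_kscale act_distrib)

end

lemma commuting_simple_module_dim:
  fixes F :: "('v, 'k::alg_closed_field) ncpoly set"
    and act :: "('v, 'k) ncpoly set \<Rightarrow> 'm::ab_group_add \<Rightarrow> 'm"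
  assumes simple: "simple_module (presented F) act"
    and fin: "finite_dimensional (kscale F act)"
    and comm: "\<And>u v x. act (toalg F (ncvar u)) (act (toalg F (ncvar v)) x)
      = act (toalg F (ncvar v)) (act (toalg F (ncvar u)) x)"
  shows "vector_space.dim (kscale F act) UNIV = 1"
proof -
  have module: "left_module (presented F) act" using simple by (simp add: simple_module_def)
  have submodule: "N = UNIV" if "0 \<in> N" "\<And>x y. x \<in> N \<Longrightarrow> y \<in> N \<Longrightarrow> x + y \<in> N"
    "\<And>f x. x \<in> N \<Longrightarrow> act (toalg F f) x \<in> N" "y \<in> N" "y \<noteq> 0" for N y
  proof -
    have "N = {0} \<or> N = UNIV"
      using simple that(1-3) unfolding simple_module_def carrier_presented by (simp add: ball_simps)
    then show ?thesis using that(4,5) by blast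
  qed
  obtain x :: 'm where x: "x \<noteq> 0" using simple by (auto simp: simple_module_def)
  interpret V: vector_space "kscale F act" by (rule kscale_vector_space[OF module])
  obtain B where B: "finite B" "V.span B = UNIV" using fin by (auto simp: finite_dimensional_def)
  have "\<exists>c. \<forall>y. act (toalg F (ncvar v)) y = kscale F act c y" for v
  proof -
    obtain c y where y: "y \<noteq> 0" "act (toalg F (ncvar v)) y = kscale F act c y"
      by (rule V.eigenvector_exists[of "act (toalg F (ncvar v))", OF _ _ B x alg_closed_imp_poly_has_root])
        (simp_all add: act_distrib[OF module] act_kscale[OF module])
    let ?N = "{y. act (toalg F (ncvar v)) y = kscale F act c y}"
    have "act (toalg F (ncvar v)) (act (toalg F f) z) = kscale F act c (act (toalg F f) z)"
      if "act (toalg F (ncvar v)) z = kscale F act c z" for f z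
      using act_commute[OF module comm, of "ncvar v" f z] that by (simp add: act_kscale[OF module])
    then have "?N = UNIV"
      using y by (intro submodule) (auto simp: act_zero[OF module] act_distrib[OF module] V.scale_right_distrib)
    then show ?thesis by blast
  qed
  then obtain ev where ev: "\<And>v y. act (toalg F (ncvar v)) y = kscale F act (ev v) y" by metis
  have scalar: "\<exists>c. \<forall>y. act (toalg F f) y = kscale F act c y" for f
  proof (induction f rule: ncpoly_induct)
    case (const c)
    then show ?case by (auto simp: kscale_def)
  next
    case (add f g)
    then show ?case by (metis act_add[OF module] V.scale_left_distrib)
  next
    case (mult f g)
    then show ?case by (metis act_mult[OF module] V.scale_scale)
  qed (use ev in blast)
  have "range (\<lambda>c. kscale F act c x) = UNIV"
  proof (rule submodule)
    show "0 \<in> range (\<lambda>c. kscale F act c x)" by (metis V.scale_zero_left rangeI)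
    show "x \<in> range (\<lambda>c. kscale F act c x)" by (metis V.scale_one rangeI)
    show "y + z \<in> range (\<lambda>c. kscale F act c x)"
      if "y \<in> range (\<lambda>c. kscale F act c x)" "z \<in> range (\<lambda>c. kscale F act c x)" for y z
      using that by (auto simp flip: V.scale_left_distrib)
    show "act (toalg F f) y \<in> range (\<lambda>c. kscale F act c x)" if "y \<in> range (\<lambda>c. kscale F act c x)" for f y
      using that scalar[of f] by (auto simp: V.scale_scale)
  qed (rule x)
  then have "UNIV \<subseteq> V.span {x}" by (simp add: V.span_singleton)
  then show ?thesis
    using V.dim_unique[of "{x}" UNIV 1] x by simp
qed

text \<open>Centrality makes the right multiples of z a two-sided ideal, and this ideal annihilates
  the module because z does.\<close>

lemma action_factors_through_annihilated_central:
  assumes module: "left_module (presented F) act"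
    and central: "\<And>f. toalg F (z * f) = toalg F (f * z)"
    and kill: "\<And>x. act (toalg F z) x = 0"
  shows "action_factors (presented F) {toalg F z \<otimes>\<^bsub>presented F\<^esub> h | h. h \<in> carrier (presented F)} act"
proof -
  let ?R = "presented F"
  define J where "J = {toalg F z \<otimes>\<^bsub>?R\<^esub> h | h. h \<in> carrier ?R}"
  interpret R: ring ?R by (rule ring_presented)
  have J: "J = (\<lambda>f. toalg F (z * f)) ` UNIV"
    unfolding J_def carrier_presented by (auto simp: toalg_mult)
  have inv: "\<ominus>\<^bsub>?R\<^esub> toalg F f = toalg F (- f)" for f
    by (rule R.minus_equality) (simp_all add: toalg_zero flip: toalg_add)
  have ideal: "ideal J ?R"
  proof (rule idealI)
    show "subgroup J (add_monoid ?R)"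
    proof (rule R.add.subgroupI)
      fix a b assume "a \<in> J" "b \<in> J"
      then obtain f g where "a = toalg F (z * f)" "b = toalg F (z * g)" by (auto simp: J)
      then have "\<ominus>\<^bsub>?R\<^esub> a = toalg F (z * - f)" "a \<oplus>\<^bsub>?R\<^esub> b = toalg F (z * (f + g))"
        by (simp_all add: inv distrib_left flip: toalg_add)
      then show "\<ominus>\<^bsub>?R\<^esub> a \<in> J" "a \<oplus>\<^bsub>?R\<^esub> b \<in> J" unfolding J by (metis rangeI)+
    qed (auto simp: J)
    fix a y assume "a \<in> J" "y \<in> carrier ?R"
    then obtain f g where ab: "a = toalg F (z * f)" "y = toalg F g" by (auto simp: J carrier_presented)
    have "a \<otimes>\<^bsub>?R\<^esub> y = toalg F (z * (f * g))"
      unfolding ab by (simp add: mult.assoc flip: toalg_mult)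
    moreover have "y \<otimes>\<^bsub>?R\<^esub> a = toalg F (z * (g * f))"
      unfolding ab toalg_mult[symmetric] central[of "g * f"]
      by (simp only: toalg_mult[of _ g] central) (simp only: mult.assoc flip: toalg_mult)
    ultimately show "a \<otimes>\<^bsub>?R\<^esub> y \<in> J" "y \<otimes>\<^bsub>?R\<^esub> a \<in> J" by (auto simp: J)
  qed (rule ring_presented)
  interpret J: ideal J ?R by (rule ideal)
  have act_J: "act j x = 0" if "j \<in> J" for j x
    using that by (auto simp: J central act_mult[OF module] kill act_zero[OF module])
  \<comment> \<open>A coset acts through a chosen member; two members of one coset differ by an
    element of \<open>J\<close>, which acts as zero.\<close>
  define act' where "act' C = act (SOME r. r \<in> carrier ?R \<and> r \<in> C)" for C
  have act': "act' (J +>\<^bsub>?R\<^esub> r) x = act r x" if r: "r \<in> carrier ?R" for r x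
  proof -
    define s where "s = (SOME s. s \<in> carrier ?R \<and> s \<in> J +>\<^bsub>?R\<^esub> r)"
    have "s \<in> carrier ?R \<and> s \<in> J +>\<^bsub>?R\<^esub> r"
      unfolding s_def by (rule someI[of _ r]) (use r J.a_rcos_self in simp)
    then obtain j where "j \<in> J" "s = j \<oplus>\<^bsub>?R\<^esub> r" by (auto simp: a_r_coset_def')
    then have "act s x = act j x + act r x"
      using module r J.a_Hcarr unfolding left_module_def by blast
    then show ?thesis using act_J[OF \<open>j \<in> J\<close>] by (simp add: act'_def s_def)
  qed
  have cosets: "carrier (?R Quot J) = (\<lambda>r. J +>\<^bsub>?R\<^esub> r) ` carrier ?R"
    by (auto simp: FactRing_def A_RCOSETS_def' a_r_coset_def')
  note hom = J.rcos_ring_hom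
  have "left_module (?R Quot J) act'"
    using module
    unfolding left_module_def cosets ball_simps
    by (simp add: act' ring_hom_add[OF hom, symmetric] ring_hom_mult[OF hom, symmetric] ring_hom_one[OF hom, symmetric])
  then show ?thesis
    unfolding action_factors_def J_def[symmetric] using act' by metis
qed

section \<open>Elements of the kernel of the canonical map\<close>

context proj_scheme_aut
begin

lemma Ld_section_value:
  assumes "b \<in> Ld_sections \<aa> \<sigma> d U" "p \<in> U"
  obtains t where "b p = tclass \<aa> \<sigma> d p t"
proof -
  have "\<exists>W ts. zopen \<aa> W \<and> p \<in> W \<and> W \<subseteq> U \<and>
      (\<forall>(r, ms)\<in>set ts. r \<in> sections \<aa> 0 W \<and> length ms = d \<and>
         (\<forall>k<d. ms ! k \<in> sections \<aa> 1 (on_pts (aut_pow \<aa> \<sigma> k) ` W))) \<and>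
      (\<forall>q\<in>W. b q = tclass \<aa> \<sigma> d q (\<Sum>(r, ms)\<leftarrow>ts.
         Poly_Mapping.single (r q, map (\<lambda>k. (ms ! k) (on_pts (aut_pow \<aa> \<sigma> k) q)) [0..<d]) 1))"
    using assms unfolding Ld_sections_def by simp
  then show thesis by (elim exE conjE) (rule that, erule (1) bspec)
qed

text \<open>Lets a kernel element be recognized from a homomorphism's additivity alone. Cancellation
  is checked pointwise: if t + t' lies in the class of t, then t' lies in the span of the
  relations.\<close>

lemma tcr_add_cancel:
  assumes b: "b \<in> carrier (twisted_coordinate_ring \<aa> \<sigma>)"
    and h: "h \<in> carrier (twisted_coordinate_ring \<aa> \<sigma>)"
    and eq: "b \<oplus>\<^bsub>twisted_coordinate_ring \<aa> \<sigma>\<^esub> h = b"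
  shows "h = \<zero>\<^bsub>twisted_coordinate_ring \<aa> \<sigma>\<^esub>"
proof (rule ext)
  fix d
  have sec: "b d \<in> Ld_sections \<aa> \<sigma> d (proj_pts \<aa>)" "h d \<in> Ld_sections \<aa> \<sigma> d (proj_pts \<aa>)"
    using b h by (simp_all add: twisted_coordinate_ring_def)
  have "h d p = tclass \<aa> \<sigma> d p 0" if p: "p \<in> proj_pts \<aa>" for p
  proof -
    obtain t t' where t: "b d p = tclass \<aa> \<sigma> d p t" "h d p = tclass \<aa> \<sigma> d p t'"
      using Ld_section_value[OF sec(1) p] Ld_section_value[OF sec(2) p] by metis
    have "{x + y | x y. x \<in> b d p \<and> y \<in> h d p} = b d p"
      using fun_cong[OF fun_cong[OF eq, of d], of p] p by (simp add: twisted_coordinate_ring_def)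
    moreover have "t \<in> b d p" "t' \<in> h d p" by (simp_all add: t tclass_def additive_span.zero)
    ultimately have "t + t' \<in> b d p" by blast
    then show ?thesis by (simp add: t tclass_def[of _ _ _ _ t] tclass_eq_iff)
  qed
  moreover have "h d \<in> extensional (proj_pts \<aa>)" using sec by (simp add: Ld_sections_def)
  ultimately show "h d = \<zero>\<^bsub>twisted_coordinate_ring \<aa> \<sigma>\<^esub> d"
    by (auto simp: twisted_coordinate_ring_def tcr_zero_def extensional_def restrict_def fun_eq_iff)
qed

lemma tcr_var_concentrated:
  "tcr_var \<aa> \<sigma> v = concentrated 1 (\<lambda>p. Poly_Mapping.single (frac \<aa> p 0 1 1, [coord v p]) 1)"
  by (rule ext) (auto simp: tcr_var_def tcr_zero_def concentrated_def coord_def)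

text \<open>The product of the pulled-back units which two applications of \<open>tmult\<close>
  leave in front of a word of three coordinates; it plays the part of \<open>e\<close> in
  \<open>central_coord_commutes\<close>.\<close>

definition word_coeff :: "('v, 'k) pt \<Rightarrow> ('v, 'k) germ" where
  "word_coeff p = gmult \<aa> 0 p (gmult \<aa> 0 p (frac \<aa> p 0 1 1) (stalk_map \<aa> (aut_pow \<aa> \<sigma> 1) p (frac \<aa> (iter 1 p) 0 1 1)))
     (stalk_map \<aa> (aut_pow \<aa> \<sigma> 2) p (frac \<aa> (iter 2 p) 0 1 1))"

lemma frac_one_in_stalk: "p \<in> proj_pts \<aa> \<Longrightarrow> frac \<aa> p 0 1 1 \<in> stalk \<aa> 0 p"
  by (intro frac_in_stalk is_frac_one)

lemma word_coeff_in_stalk: "p \<in> proj_pts \<aa> \<Longrightarrow> word_coeff p \<in> stalk \<aa> 0 p"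
  unfolding word_coeff_def
  by (intro gmult_closed stalk_map_closed scheme_end_pow frac_one_in_stalk iter_closed)

lemma tcr_var_triple:
  "tcr_var \<aa> \<sigma> i \<otimes>\<^bsub>twisted_coordinate_ring \<aa> \<sigma>\<^esub> tcr_var \<aa> \<sigma> j \<otimes>\<^bsub>twisted_coordinate_ring \<aa> \<sigma>\<^esub> tcr_var \<aa> \<sigma> k
    = concentrated 3 (\<lambda>p. Poly_Mapping.single
        (word_coeff p, [coord i p, coord j (iter 1 p), coord k (iter 2 p)]) 1)"
proof -
  let ?x = "\<lambda>v p. Poly_Mapping.single (frac \<aa> p 0 1 1, [coord v p]) (1::int)"
  have x: "?x v p \<in> symbol_span 1 p" if "p \<in> proj_pts \<aa>" for v p
    using that frac_one_in_stalk coord_in_stalk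
    by (intro symbol_span_base) (simp add: symbols_iff)
  have xx: "tmult \<aa> \<sigma> 1 p (?x i p) (?x j (iter 1 p)) \<in> symbol_span (1 + 1) p" if "p \<in> proj_pts \<aa>" for p
    by (intro tmult_symbol_span x that iter_closed)
  have "tcr_var \<aa> \<sigma> i \<otimes>\<^bsub>twisted_coordinate_ring \<aa> \<sigma>\<^esub> tcr_var \<aa> \<sigma> j
      = concentrated (1 + 1) (\<lambda>p. tmult \<aa> \<sigma> 1 p (?x i p) (?x j (iter 1 p)))"
    unfolding tcr_var_concentrated by (rule mult_concentrated) (rule x, assumption)+
  moreover have "concentrated (1 + 1) (\<lambda>p. tmult \<aa> \<sigma> 1 p (?x i p) (?x j (iter 1 p)))
        \<otimes>\<^bsub>twisted_coordinate_ring \<aa> \<sigma>\<^esub> tcr_var \<aa> \<sigma> k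
      = concentrated (1 + 1 + 1) (\<lambda>p. tmult \<aa> \<sigma> (1 + 1) p (tmult \<aa> \<sigma> 1 p (?x i p) (?x j (iter 1 p)))
          (?x k (iter (1 + 1) p)))"
    unfolding tcr_var_concentrated by (rule mult_concentrated) (rule xx x, assumption)+
  ultimately show ?thesis
    by (simp add: tmult_single word_coeff_def numeral_3_eq_3 numeral_2_eq_2 del: aut_pow.simps)
qed

context
  fixes F \<phi> z
  assumes canonical: "canonical_map F \<aa> \<sigma> \<phi>"
    and central: "\<And>v. toalg F (ncvar z * ncvar v) = toalg F (ncvar v * ncvar z)"
begin

lemma canonical_word:
  "\<phi> (toalg F (ncvar i * ncvar j * ncvar k)) = concentrated 3 (\<lambda>p. Poly_Mapping.single
     (word_coeff p, [coord i p, coord j (iter 1 p), coord k (iter 2 p)]) 1)"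
proof -
  have hom: "\<phi> \<in> ring_hom (presented F) (twisted_coordinate_ring \<aa> \<sigma>)"
    and var: "\<And>v. \<phi> (toalg F (ncvar v)) = tcr_var \<aa> \<sigma> v"
    using canonical by (simp_all add: canonical_map_def)
  have "\<phi> (toalg F (f * g)) = \<phi> (toalg F f) \<otimes>\<^bsub>twisted_coordinate_ring \<aa> \<sigma>\<^esub> \<phi> (toalg F g)" for f g
    using ring_hom_mult[OF hom toalg_closed toalg_closed] by (simp add: toalg_mult)
  then show ?thesis unfolding tcr_var_triple[symmetric] by (simp add: var)
qed

lemma commutator_in_kernel:
  "toalg F ((ncvar i * ncvar j - ncvar j * ncvar i) * ncvar z)
     \<in> a_kernel (presented F) (twisted_coordinate_ring \<aa> \<sigma>) \<phi>"
proof -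
  have hom: "\<phi> \<in> ring_hom (presented F) (twisted_coordinate_ring \<aa> \<sigma>)"
    using canonical by (simp add: canonical_map_def)
  let ?x = "ncvar :: _ \<Rightarrow> ('v, 'k) ncpoly"
  \<comment> \<open>Both extreme positions of z are moved to the middle one, so each required
    identity of words is reduced to a common normal form.\<close>
  have zl: "toalg F (?x z * ?x i * ?x j) = toalg F (?x i * ?x z * ?x j)" for i j
    by (simp only: toalg_mult[of _ "_ * _"] central)
  have zr: "toalg F (?x i * ?x j * ?x z) = toalg F (?x i * ?x z * ?x j)" for i j
    unfolding mult.assoc by (simp only: toalg_mult[of _ _ "_ * _"] central)
  have class_eq: "tclass \<aa> \<sigma> 3 p (Poly_Mapping.single
        (word_coeff p, [coord i p, coord j (iter 1 p), coord k (iter 2 p)]) 1)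
      = tclass \<aa> \<sigma> 3 p (Poly_Mapping.single
        (word_coeff p, [coord i' p, coord j' (iter 1 p), coord k' (iter 2 p)]) 1)"
    if "p \<in> proj_pts \<aa>" "toalg F (?x i * ?x j * ?x k) = toalg F (?x i' * ?x j' * ?x k')" for p i j k i' j' k'
    using fun_cong[OF fun_cong[OF arg_cong[OF that(2), of \<phi>, unfolded canonical_word], of 3], of p] that(1)
    by (simp add: concentrated_def del: aut_pow.simps)
  have "tclass \<aa> \<sigma> 3 p (Poly_Mapping.single
        (word_coeff p, [coord i p, coord j (iter 1 p), coord z (iter 2 p)]) 1)
      = tclass \<aa> \<sigma> 3 p (Poly_Mapping.single
        (word_coeff p, [coord j p, coord i (iter 1 p), coord z (iter 2 p)]) 1)"
    if p: "p \<in> proj_pts \<aa>" for p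
    by (rule central_coord_commutes[OF p word_coeff_in_stalk[OF p]]) (rule class_eq[OF p], simp only: zl zr)+
  then have eq: "\<phi> (toalg F (?x i * ?x j * ?x z)) = \<phi> (toalg F (?x j * ?x i * ?x z))"
    unfolding canonical_word by (auto simp: concentrated_def fun_eq_iff restrict_def)
  \<comment> \<open>The commutator is written as a summand rather than as a difference, which fits
    the additivity of \<open>\<phi>\<close> and the cancellation rule in B.\<close>
  have "toalg F (?x i * ?x j * ?x z)
      = toalg F (?x j * ?x i * ?x z) \<oplus>\<^bsub>presented F\<^esub> toalg F ((?x i * ?x j - ?x j * ?x i) * ?x z)"
    by (simp add: algebra_simps flip: toalg_add)
  then have "\<phi> (toalg F (?x j * ?x i * ?x z)) \<oplus>\<^bsub>twisted_coordinate_ring \<aa> \<sigma>\<^esub>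
      \<phi> (toalg F ((?x i * ?x j - ?x j * ?x i) * ?x z)) = \<phi> (toalg F (?x j * ?x i * ?x z))"
    using eq ring_hom_add[OF hom, of "toalg F (?x j * ?x i * ?x z)"] by simp
  then show ?thesis
    unfolding a_kernel_def'
    using tcr_add_cancel[OF ring_hom_closed[OF hom toalg_closed] ring_hom_closed[OF hom toalg_closed]] by simp
qed

end

end

theorem theorem4p11:
  fixes fs :: "('v::finite list \<Rightarrow>\<^sub>0 'k::{alg_closed_field, field_char_0}) list"
    and \<aa> :: "('v option, 'k) mpoly set"
    and \<sigma> :: "('v option, 'k) scheme_map"
    and \<phi> :: "('v option, 'k) ncpoly set \<Rightarrow> nat \<Rightarrow> ('v option, 'k) pt \<Rightarrow> ('v option, 'k) tensor"
    and I :: "('v option, 'k) ncpoly set set"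
    and act :: "('v option, 'k) ncpoly set \<Rightarrow> 'm::ab_group_add \<Rightarrow> 'm"
  defines "gr_rels \<equiv> leading_form ` set fs"
    and "H_rels \<equiv> homogenization_rels (set fs)"
  assumes "PBW_deformation (set fs)"
    and "noetherian (gr_algebra (set fs))"
    and "quadratic_algebra gr_rels"
    and "geometric_algebra gr_rels"
    and "geometric_data H_rels \<aa> \<sigma>"
    and "canonical_map H_rels \<aa> \<sigma> \<phi>"
    and "I = a_kernel (presented H_rels) (twisted_coordinate_ring \<aa> \<sigma>) \<phi>"
    and "simple_module (presented H_rels) act"
    and "finite_dimensional (kscale H_rels act)"
    and "\<forall>h\<in>I. \<forall>x. act h x = 0"
  shows "action_factors (presented H_rels)
           {toalg H_rels (ncvar None) \<otimes>\<^bsub>presented H_rels\<^esub> h | h. h \<in> carrier (presented H_rels)} act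
         \<or> vector_space.dim (kscale H_rels act) UNIV = 1"
proof -
  let ?z = "ncvar None :: ('v option, 'k) ncpoly"
  interpret proj_scheme_aut \<aa> \<sigma>
    using \<open>geometric_data H_rels \<aa> \<sigma>\<close>
    by (intro proj_scheme_aut.intro proj_scheme.intro proj_scheme_aut_axioms.intro)
      (simp_all add: geometric_data_def homogeneous_ideal_def)
  have module: "left_module (presented H_rels) act"
    using \<open>simple_module (presented H_rels) act\<close> by (simp add: simple_module_def)
  have z_var: "toalg H_rels (?z * ncvar v) = toalg H_rels (ncvar v * ?z)" for v
  proof (cases v)
    case (Some i)
    then show ?thesis
      by (intro toalg_eqI) (auto simp: H_rels_def homogenization_rels_def)
  qed simp
  have central: "toalg H_rels (?z * f) = toalg H_rels (f * ?z)" for f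
  proof (induction f rule: ncpoly_induct)
    case (const c)
    then show ?case by (simp add: ncconst_mult)
  next
    case (add f g)
    then show ?case by (simp add: distrib_left distrib_right toalg_add)
  next
    case (mult f g)
    have "toalg H_rels (?z * (f * g)) = toalg H_rels (f * ?z * g)"
      using mult by (simp add: toalg_mult[of _ _ g] flip: mult.assoc)
    also have "\<dots> = toalg H_rels (f * g * ?z)"
      using mult by (simp add: toalg_mult[of _ f] mult.assoc)
    finally show ?case .
  qed (rule z_var)
  show ?thesis
  proof (cases "\<forall>x. act (toalg H_rels ?z) x = 0")
    case True
    then show ?thesis
      using action_factors_through_annihilated_central[OF module central] by blast
  next
    case False
    have "range (act (toalg H_rels ?z)) = {0} \<or> range (act (toalg H_rels ?z)) = UNIV"
    proof -
      have "0 \<in> range (act (toalg H_rels ?z))" by (metis act_zero[OF module] rangeI)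
      moreover have "x + y \<in> range (act (toalg H_rels ?z))"
        if "x \<in> range (act (toalg H_rels ?z))" "y \<in> range (act (toalg H_rels ?z))" for x y
        using that by (auto simp flip: act_distrib[OF module])
      moreover have "act (toalg H_rels f) x \<in> range (act (toalg H_rels ?z))"
        if x: "x \<in> range (act (toalg H_rels ?z))" for f x
      proof -
        obtain y where "x = act (toalg H_rels ?z) y" using x by blast
        then have "act (toalg H_rels f) x = act (toalg H_rels ?z) (act (toalg H_rels f) y)"
          by (metis act_mult[OF module] central)
        then show ?thesis by simp
      qed
      ultimately show ?thesis
        using \<open>simple_module (presented H_rels) act\<close>
        unfolding simple_module_def carrier_presented by (simp add: ball_simps)
    qed
    then have surj: "range (act (toalg H_rels ?z)) = UNIV" using False by auto
    have "act (toalg H_rels (ncvar u)) (act (toalg H_rels (ncvar v)) x)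
        = act (toalg H_rels (ncvar v)) (act (toalg H_rels (ncvar u)) x)" for u v x
    proof -
      \<comment> \<open>Only the commutator times x_0 is known to lie in I; writing x as x_0 y
        supplies that missing factor.\<close>
      obtain y where y: "x = act (toalg H_rels ?z) y" using surj by auto
      have "act (toalg H_rels ((ncvar u * ncvar v - ncvar v * ncvar u) * ?z)) y = 0"
        by (rule \<open>\<forall>h\<in>I. \<forall>x. act h x = 0\<close>[THEN bspec, THEN spec])
          (unfold \<open>I = a_kernel (presented H_rels) (twisted_coordinate_ring \<aa> \<sigma>) \<phi>\<close>,
            rule commutator_in_kernel[OF \<open>canonical_map H_rels \<aa> \<sigma> \<phi>\<close> z_var])
      then show ?thesis
        by (simp add: y act_mult[OF module] act_diff[OF module])
    qed
    from commuting_simple_module_dim[OF \<open>simple_module (presented H_rels) act\<close>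
        \<open>finite_dimensional (kscale H_rels act)\<close> this]
    show ?thesis ..
  qed
qed

end
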